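(* Let $(\omega_v)_{v\in V}$ be a finite family of linearly independent 1-forms on the upper half plane $H$ of the form $\omega_v=f_v(z)z^{m_v-1}dz$, where each $f_v$ is a cusp form of some weight $2r_v$ with respect to a congruence subgroup of $SL_2(\mathbb{Z})$ and $m_v$ is an integer with $1\le m_v\le 2r_v-1$. Let $\Gamma$ be a subgroup of $SL_2(\mathbb{Z})$ such that for each $\gamma\in\Gamma$ the pull-back $\gamma^*$ maps the linear span of $(\omega_v)$ into itself. Let $\Pi$ be the multiplicative group of power series in $\mathbb{C}\langle\langle A_V\rangle\rangle$ with constant term $1$, with the left action of $\Gamma$ given by $J\mapsto\gamma_*J$. Then: (i) For each $a\in\mathbb{P}^1(\mathbb{Q})$, the map $\zeta_a:\Gamma\to\Pi$, $\gamma\mapsto J^a_{\gamma a}(\omega_V)$, is a noncommutative 1-cocycle in $Z^1(\Gamma,\Pi)$, i.e. $\zeta_a(\gamma\beta)=\zeta_a(\gamma)\cdot\gamma_*(\zeta_a(\beta))$ for all $\gamma,\beta\in\Gamma$. (ii) The cohomology class of $\zeta_a$ in $H^1(\Gamma,\Pi)$ does not depend on the choice of $a$; that is, for all $a,b\in\mathbb{P}^1(\mathbb{Q})$ there is $c\in\Pi$ with $\zeta_a(\gamma)=c\cdot\zeta_b(\gamma)\cdot(\gamma_*c)^{-1}$ for all $\gamma\in\Gamma$.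
   Context: $\mathbb{C}\langle\langle A_V\rangle\rangle$ is the ring of associative formal power series in free noncommuting variables $A_v$, $v\in V$. $SL_2(\mathbb{Z})$ acts on $H\cup\mathbb{P}^1(\mathbb{Q})$ by fractional linear transformations. For cusps $b,a\in\mathbb{P}^1(\mathbb{Q})$, iterated integrals are taken along the geodesic $\delta:(0,1)\to H$ from $b$ to $a$: $$I_b^a(\omega_1,\dots,\omega_n)=\int_{1>t_1>\dots>t_n>0}\delta^*\omega_1(t_1)\cdots\delta^*\omega_n(t_n)$$ (absolutely convergent for the forms considered), and $$J_b^a(\omega_V)=1+\sum_{n\ge1}\sum_{(v_1,\dots,v_n)\in V^n}A_{v_1}\cdots A_{v_n}\,I_b^a(\omega_{v_1},\dots,\omega_{v_n}),$$ with $J_a^a=1$. For $\gamma\in\Gamma$ write $\gamma^*(\omega_v)=\sum_u g_{vu}\omega_u$; then $\gamma_*$ is the continuous $\mathbb{C}$-algebra automorphism of $\mathbb{C}\langle\langle A_V\rangle\rangle$ with $\gamma_*(A_u)=\sum_vA_vg_{vu}$. *)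

theory Defs
  imports "HOL-Analysis.Analysis" "HOL-Algebra.QuotRing"
begin

section \<open>The modular group, cusps and cusp forms\<close>

definition upper_half_plane :: "complex set" where
  "upper_half_plane = {z. Im z > 0}"

definition SL2Z :: "(int^2^2) monoid" where
  "SL2Z = \<lparr>carrier = {A. det A = 1}, mult = (**), one = mat 1\<rparr>"

definition principal_congruence_subgroup :: "nat \<Rightarrow> (int^2^2) set" where
  "principal_congruence_subgroup N =
     {A \<in> carrier SL2Z. \<forall>i j. A $ i $ j mod int N = (mat 1 :: int^2^2) $ i $ j mod int N}"

definition congruence_subgroup :: "(int^2^2) set \<Rightarrow> bool" where
  "congruence_subgroup G \<longleftrightarrow>
     subgroup G SL2Z \<and> (\<exists>N\<ge>1. principal_congruence_subgroup N \<subseteq> G)"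

definition aut_factor :: "int^2^2 \<Rightarrow> complex \<Rightarrow> complex" where
  "aut_factor A z = of_int (A $ 2 $ 1) * z + of_int (A $ 2 $ 2)"

definition frac_lin :: "int^2^2 \<Rightarrow> complex \<Rightarrow> complex" where
  "frac_lin A z = (of_int (A $ 1 $ 1) * z + of_int (A $ 1 $ 2)) / aut_factor A z"

text \<open>The projective line over the rationals.\<close>

datatype cusp = Cusp_Infinity | Cusp rat

fun cusp_act :: "int^2^2 \<Rightarrow> cusp \<Rightarrow> cusp" where
  "cusp_act A Cusp_Infinity =
     (if A $ 2 $ 1 = 0 then Cusp_Infinity
      else Cusp (of_int (A $ 1 $ 1) / of_int (A $ 2 $ 1)))"
| "cusp_act A (Cusp q) =
     (if of_int (A $ 2 $ 1) * q + of_int (A $ 2 $ 2) = 0 then Cusp_Infinity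
      else Cusp ((of_int (A $ 1 $ 1) * q + of_int (A $ 1 $ 2)) /
                 (of_int (A $ 2 $ 1) * q + of_int (A $ 2 $ 2))))"

definition slash :: "nat \<Rightarrow> int^2^2 \<Rightarrow> (complex \<Rightarrow> complex) \<Rightarrow> complex \<Rightarrow> complex" where
  "slash k A f z = f (frac_lin A z) / aut_factor A z ^ k"

text \<open>The last condition is the vanishing at every cusp: every translate of \<open>f\<close> under the
  full modular group tends to \<open>0\<close> as \<open>Im z\<close> tends to infinity, uniformly in \<open>Re z\<close>.\<close>

definition cusp_form :: "(int^2^2) set \<Rightarrow> nat \<Rightarrow> (complex \<Rightarrow> complex) \<Rightarrow> bool" where
  "cusp_form G k f \<longleftrightarrow>
     f holomorphic_on upper_half_plane \<and>
     (\<forall>A\<in>G. \<forall>z\<in>upper_half_plane. slash k A f z = f z) \<and>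
     (\<forall>A\<in>carrier SL2Z. (slash k A f \<longlongrightarrow> 0) (filtercomap Im at_top))"


section \<open>One-forms on the upper half plane\<close>

text \<open>A 1-form \<open>F(z) dz\<close> is represented by its coefficient function \<open>F\<close>, of which only the
  values on the upper half plane are significant.\<close>

definition pullback_form :: "(complex \<Rightarrow> complex) \<Rightarrow> (complex \<Rightarrow> complex) \<Rightarrow> complex \<Rightarrow> complex" where
  "pullback_form \<phi> F z = F (\<phi> z) * deriv \<phi> z"

definition lin_indep_forms :: "'v set \<Rightarrow> ('v \<Rightarrow> complex \<Rightarrow> complex) \<Rightarrow> bool" where
  "lin_indep_forms V \<omega> \<longleftrightarrow>
     (\<forall>c. (\<forall>z\<in>upper_half_plane. (\<Sum>v\<in>V. c v * \<omega> v z) = 0) \<longrightarrow> (\<forall>v\<in>V. c v = 0))"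

definition span_forms :: "'v set \<Rightarrow> ('v \<Rightarrow> complex \<Rightarrow> complex) \<Rightarrow> (complex \<Rightarrow> complex) set" where
  "span_forms V \<omega> = {F. \<exists>c. \<forall>z\<in>upper_half_plane. F z = (\<Sum>v\<in>V. c v * \<omega> v z)}"

text \<open>The matrix \<open>g\<close> with \<open>\<gamma>\<^sup>*(\<omega>\<^sub>v) = \<Sum>\<^sub>u g\<^sub>v\<^sub>u \<omega>\<^sub>u\<close>; for linearly independent
  \<open>\<omega>\<close> its entries with indices in \<open>V\<close> are unique.\<close>

definition pullback_matrix ::
    "'v set \<Rightarrow> ('v \<Rightarrow> complex \<Rightarrow> complex) \<Rightarrow> int^2^2 \<Rightarrow> 'v \<Rightarrow> 'v \<Rightarrow> complex" where
  "pullback_matrix V \<omega> \<gamma> =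
     (SOME g. \<forall>v\<in>V. \<forall>z\<in>upper_half_plane.
        pullback_form (frac_lin \<gamma>) (\<omega> v) z = (\<Sum>u\<in>V. g v u * \<omega> u z))"


section \<open>Noncommutative formal power series\<close>

text \<open>A series in the free variables \<open>A\<^sub>v\<close>, \<open>v \<in> V\<close>, is given by its coefficients:
  \<open>S [v\<^sub>1, \<dots>, v\<^sub>n]\<close> is the coefficient of \<open>A\<^bsub>v\<^sub>1\<^esub> \<cdots> A\<^bsub>v\<^sub>n\<^esub>\<close>.\<close>

type_synonym 'v nc_series = "'v list \<Rightarrow> complex"

definition nc_ring :: "'v set \<Rightarrow> 'v nc_series ring" where
  "nc_ring V =
     \<lparr>carrier = {S. \<forall>w. w \<notin> lists V \<longrightarrow> S w = 0},
      mult = (\<lambda>S T w. \<Sum>i\<le>length w. S (take i w) * T (drop i w)),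
      one = (\<lambda>w. if w = [] then 1 else 0),
      zero = (\<lambda>w. 0),
      add = (\<lambda>S T w. S w + T w)\<rparr>"

definition nc_smult :: "complex \<Rightarrow> 'v nc_series \<Rightarrow> 'v nc_series" where
  "nc_smult c S = (\<lambda>w. c * S w)"

definition nc_var :: "'v \<Rightarrow> 'v nc_series" where
  "nc_var v = (\<lambda>w. if w = [v] then 1 else 0)"

text \<open>For finite \<open>V\<close>, coefficientwise (discrete) convergence is convergence with respect to the
  powers of the augmentation ideal.\<close>

definition nc_topology :: "'v set \<Rightarrow> 'v nc_series topology" where
  "nc_topology V =
     subtopology (product_topology (\<lambda>_. discrete_topology UNIV) UNIV) (carrier (nc_ring V))"

definition cont_alg_automorphism :: "'v set \<Rightarrow> ('v nc_series \<Rightarrow> 'v nc_series) \<Rightarrow> bool" where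
  "cont_alg_automorphism V \<phi> \<longleftrightarrow>
     \<phi> \<in> ring_iso (nc_ring V) (nc_ring V) \<and>
     (\<forall>c. \<forall>S\<in>carrier (nc_ring V). \<phi> (nc_smult c S) = nc_smult c (\<phi> S)) \<and>
     continuous_map (nc_topology V) (nc_topology V) \<phi>"

text \<open>The automorphism \<open>\<gamma>\<^sub>*\<close>; it is determined on the carrier of \<open>nc_ring V\<close> by its values
  on the variables.\<close>

definition lower_star ::
    "'v set \<Rightarrow> ('v \<Rightarrow> complex \<Rightarrow> complex) \<Rightarrow> int^2^2 \<Rightarrow> 'v nc_series \<Rightarrow> 'v nc_series" where
  "lower_star V \<omega> \<gamma> =
     (SOME \<phi>. cont_alg_automorphism V \<phi> \<and>
        (\<forall>u\<in>V. \<phi> (nc_var u) =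
           (\<lambda>w. \<Sum>v\<in>V. nc_smult (pullback_matrix V \<omega> \<gamma> v u) (nc_var v) w)))"

definition nc_Pi :: "'v set \<Rightarrow> 'v nc_series monoid" where
  "nc_Pi V =
     \<lparr>carrier = {S \<in> carrier (nc_ring V). S [] = 1},
      mult = mult (nc_ring V), one = one (nc_ring V)\<rparr>"


section \<open>Iterated integrals between cusps\<close>

text \<open>A parametrization by \<open>(0,1)\<close> of the hyperbolic geodesic from \<open>b\<close> to \<open>a\<close>, for
  \<open>b \<noteq> a\<close>: a half circle with end points \<open>b\<close> and \<open>a\<close>, or a vertical half line.  The iterated
  integrals do not depend on the choice of the parametrization.\<close>

fun geodesic :: "cusp \<Rightarrow> cusp \<Rightarrow> real \<Rightarrow> complex" where
  "geodesic (Cusp b) (Cusp a) t =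
     Complex ((of_rat a + of_rat b) / 2 + (of_rat b - of_rat a) / 2 * cos (pi * t))
             (\<bar>of_rat a - of_rat b\<bar> / 2 * sin (pi * t))"
| "geodesic (Cusp b) Cusp_Infinity t = Complex (of_rat b) (t / (1 - t))"
| "geodesic Cusp_Infinity (Cusp a) t = Complex (of_rat a) ((1 - t) / t)"
| "geodesic Cusp_Infinity Cusp_Infinity t = undefined"

text \<open>The integral over \<open>1 > t\<^sub>1 > \<dots> > t\<^sub>n > 0\<close>, where \<open>t\<^sub>i\<close> is \<open>t (i - 1)\<close>.\<close>

definition open_simplex :: "nat \<Rightarrow> (nat \<Rightarrow> real) set" where
  "open_simplex n =
     {t. (\<forall>i<n. 0 < t i \<and> t i < 1) \<and> (\<forall>i<n. \<forall>j<n. i < j \<longrightarrow> t j < t i)}"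

definition iterated_integral :: "cusp \<Rightarrow> cusp \<Rightarrow> (complex \<Rightarrow> complex) list \<Rightarrow> complex" where
  "iterated_integral b a Fs =
     set_lebesgue_integral (PiM {..<length Fs} (\<lambda>_. lborel)) (open_simplex (length Fs))
       (\<lambda>t. \<Prod>i<length Fs.
          (Fs ! i) (geodesic b a (t i)) * vector_derivative (geodesic b a) (at (t i)))"

text \<open>\<open>nc_J V \<omega> b a\<close> is \<open>J\<^sub>b\<^sup>a(\<omega>\<^sub>V)\<close>.\<close>

definition nc_J :: "'v set \<Rightarrow> ('v \<Rightarrow> complex \<Rightarrow> complex) \<Rightarrow> cusp \<Rightarrow> cusp \<Rightarrow> 'v nc_series" where
  "nc_J V \<omega> b a =
     (if b = a then one (nc_ring V)
      else (\<lambda>w. if w = [] then 1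
                else if w \<in> lists V then iterated_integral b a (map \<omega> w) else 0))"


section \<open>Noncommutative group cohomology\<close>

definition nc_cocycles ::
    "('g, 'r) monoid_scheme \<Rightarrow> ('m, 's) monoid_scheme \<Rightarrow> ('g \<Rightarrow> 'm \<Rightarrow> 'm) \<Rightarrow> ('g \<Rightarrow> 'm) set" where
  "nc_cocycles G M act =
     {\<zeta> \<in> carrier G \<rightarrow> carrier M. \<forall>\<gamma>\<in>carrier G. \<forall>\<beta>\<in>carrier G.
        \<zeta> (\<gamma> \<otimes>\<^bsub>G\<^esub> \<beta>) = \<zeta> \<gamma> \<otimes>\<^bsub>M\<^esub> act \<gamma> (\<zeta> \<beta>)}"

text \<open>The pairs of cocycles with the same class in \<open>H\<^sup>1(G, M)\<close>.\<close>

definition cohomologous ::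
    "('g, 'r) monoid_scheme \<Rightarrow> ('m, 's) monoid_scheme \<Rightarrow> ('g \<Rightarrow> 'm \<Rightarrow> 'm) \<Rightarrow>
     (('g \<Rightarrow> 'm) \<times> ('g \<Rightarrow> 'm)) set" where
  "cohomologous G M act =
     {(\<zeta>, \<eta>). \<zeta> \<in> nc_cocycles G M act \<and> \<eta> \<in> nc_cocycles G M act \<and>
        (\<exists>c\<in>carrier M. \<forall>\<gamma>\<in>carrier G.
           \<zeta> \<gamma> = c \<otimes>\<^bsub>M\<^esub> \<eta> \<gamma> \<otimes>\<^bsub>M\<^esub> inv\<^bsub>M\<^esub> (act \<gamma> c))}"

definition zeta :: "'v set \<Rightarrow> ('v \<Rightarrow> complex \<Rightarrow> complex) \<Rightarrow> cusp \<Rightarrow> int^2^2 \<Rightarrow> 'v nc_series" where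
  "zeta V \<omega> a \<gamma> = nc_J V \<omega> (cusp_act \<gamma> a) a"

end

theory Submission
  imports Defs "HOL-Complex_Analysis.Cauchy_Integral_Formula" "HOL-Real_Asymp.Real_Asymp"
begin

no_notation fps_nth (infixl "$" 75)

text \<open>
  Everything rests on three properties of the series \<open>J\<^sub>b\<^sup>a\<close>: \<open>J\<^sub>a\<^sup>a = 1\<close>, the composition law
  \<open>J\<^sub>c\<^sup>a = J\<^sub>b\<^sup>a J\<^sub>c\<^sup>b\<close>, and equivariance, \<open>J\<close> from \<open>\<gamma> b\<close> to \<open>\<gamma> a\<close> being \<open>\<gamma>\<^sub>* J\<^sub>b\<^sup>a\<close>.  With them
  the path from \<open>\<gamma> \<beta> a\<close> to \<open>a\<close> through \<open>\<gamma> a\<close> gives the cocycle identity, and the path from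
  \<open>\<gamma> a\<close> to \<open>a\<close> through \<open>\<gamma> b\<close> and \<open>b\<close> shows that \<open>c = J\<^sub>b\<^sup>a\<close> relates the cocycles at \<open>a\<close> and \<open>b\<close>.

  As integrals along geodesics the series do not show these properties, since the geodesics from
  \<open>c\<close> to \<open>b\<close>, from \<open>b\<close> to \<open>a\<close> and from \<open>c\<close> to \<open>a\<close> form a triangle.  So \<open>J\<^sub>b\<^sup>a\<close> is characterized
  without paths: there is a unique solution \<open>J\<^sub>b\<^sup>z\<close>, holomorphic on the upper half plane, of
  \<open>d J = (\<Sum>\<^sub>v A\<^sub>v \<omega>\<^sub>v) J\<close> with limit \<open>1\<close> at \<open>b\<close>; its coefficients are the iterated primitives
  \<open>iter_prim\<close>, which exist because the upper half plane is convex.  It has a limit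
  at every cusp \<open>a\<close>, called \<open>iter_lim\<close>.  Two solutions of the equation differ by a
  constant right factor, which gives the composition law (\<open>iter_lim_compose\<close>); pulling
  the equation back by \<open>\<gamma>\<close> gives equivariance (\<open>iter_lim_equivariant\<close>).

  Two analytic points remain.  The limits at the cusps exist because a cusp form decays
  exponentially there: it is a holomorphic function of \<open>q = exp (2 \<pi> i z / N)\<close> vanishing
  at \<open>q = 0\<close> (\<open>cusp_decay_form\<close>, \<open>cusp_primitive\<close>).  And the integral over the simplex is
  \<open>iter_lim\<close> by Fubini and the fundamental theorem of calculus along the geodesic
  (\<open>nc_J_eq_iter_lim\<close>), because a geodesic with an end at \<open>A \<infinity>\<close> is a vertical line in the
  coordinate \<open>A\<^sup>-\<^sup>1 z\<close>, so that it stays in the strips along which the limits are taken.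

  Algebraically, \<open>\<gamma>\<^sub>*\<close> has to be recovered from its description as the continuous automorphism
  with given values on the variables.  The substitution \<open>nc_subst\<close> is such an automorphism,
  bijective because \<open>\<gamma>\<close> is invertible and the forms are independent, and it is the only one
  because noncommutative polynomials are dense (\<open>cont_alg_automorphism_unique\<close>).
\<close>

section \<open>Noncommutative series and linear substitutions\<close>

definition nc_mult :: "'v nc_series \<Rightarrow> 'v nc_series \<Rightarrow> 'v nc_series" where
  "nc_mult S T = (\<lambda>w. \<Sum>i\<le>length w. S (take i w) * T (drop i w))"

definition nc_one :: "'v nc_series" where
  "nc_one = (\<lambda>w. if w = [] then 1 else 0)"

lemma nc_ring_simps:
  "carrier (nc_ring V) = {S. \<forall>w. w \<notin> lists V \<longrightarrow> S w = 0}"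
  "S \<otimes>\<^bsub>nc_ring V\<^esub> T = nc_mult S T" "\<one>\<^bsub>nc_ring V\<^esub> = nc_one"
  "S \<oplus>\<^bsub>nc_ring V\<^esub> T = (\<lambda>w. S w + T w)" "\<zero>\<^bsub>nc_ring V\<^esub> = (\<lambda>w. 0)"
  by (auto simp: nc_ring_def nc_mult_def nc_one_def)

lemma nc_Pi_simps:
  "carrier (nc_Pi V) = {S \<in> carrier (nc_ring V). S [] = 1}"
  "S \<otimes>\<^bsub>nc_Pi V\<^esub> T = nc_mult S T" "\<one>\<^bsub>nc_Pi V\<^esub> = nc_one"
  by (auto simp: nc_Pi_def nc_ring_def nc_mult_def nc_one_def)

lemma nc_mult_Nil [simp]: "nc_mult S T [] = S [] * T []"
  by (simp add: nc_mult_def)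

lemma nc_mult_Cons:
  "nc_mult S T (v # w) = S [] * T (v # w) + nc_mult (\<lambda>x. S (v # x)) T w"
  unfolding nc_mult_def length_Cons sum.atMost_Suc_shift by simp

lemma nc_mult_add_left: "nc_mult (\<lambda>w. S w + S' w) T w = nc_mult S T w + nc_mult S' T w"
  by (simp add: nc_mult_def sum.distrib algebra_simps)

lemma nc_mult_smult_left: "nc_mult (\<lambda>w. c * S w) T w = c * nc_mult S T w"
  by (simp add: nc_mult_def sum_distrib_left algebra_simps)

lemma nc_mult_sum_left:
  "nc_mult (\<lambda>w. \<Sum>u\<in>U. S u w) T w = (\<Sum>u\<in>U. nc_mult (S u) T w)"
  unfolding nc_mult_def by (simp add: sum_distrib_right sum.swap[of _ U])

lemma nc_mult_one_left [simp]: "nc_mult nc_one S = S"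
proof
  fix w show "nc_mult nc_one S w = S w"
  proof (cases w)
    case (Cons v x)
    have "nc_mult (\<lambda>y. nc_one (v # y)) S x = 0" by (simp add: nc_mult_def nc_one_def)
    then show ?thesis by (simp add: Cons nc_mult_Cons) (simp add: nc_one_def)
  qed (simp add: nc_one_def)
qed

lemma nc_mult_one_right [simp]: "nc_mult S nc_one = S"
proof
  fix w show "nc_mult S nc_one w = S w"
    by (induction w arbitrary: S) (auto simp: nc_mult_Cons nc_one_def)
qed

lemma nc_mult_assoc: "nc_mult (nc_mult S T) U = nc_mult S (nc_mult T U)"
proof
  fix w show "nc_mult (nc_mult S T) U w = nc_mult S (nc_mult T U) w"
    by (induction w arbitrary: S)
       (auto simp: nc_mult_Cons nc_mult_add_left nc_mult_smult_left algebra_simps)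
qed

lemma nc_mult_carrier:
  assumes "S \<in> carrier (nc_ring V)" "T \<in> carrier (nc_ring V)"
  shows "nc_mult S T \<in> carrier (nc_ring V)"
proof -
  have *: "S (take i w) * T (drop i w) = 0" if "w \<notin> lists V" for i w
  proof -
    have "take i w \<notin> lists V \<or> drop i w \<notin> lists V"
      using that by (metis append_take_drop_id append_in_lists_conv)
    then show ?thesis using assms by (auto simp: nc_ring_simps)
  qed
  show ?thesis unfolding nc_ring_simps nc_mult_def by (simp add: *)
qed

lemma monoid_nc_Pi: "monoid (nc_Pi V)"
  by (rule monoidI)
     (auto simp: nc_Pi_simps nc_mult_carrier nc_mult_assoc, auto simp: nc_ring_simps nc_one_def)

text \<open>The substitution \<open>A\<^sub>u \<mapsto> \<Sum>\<^sub>v A\<^sub>v g\<^sub>v\<^sub>u\<close> is defined by recursion on the word whose coefficient is taken;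
  passing from \<open>S\<close> to \<open>\<lambda>x. S (u # x)\<close> strips a leading variable \<open>A\<^sub>u\<close>, and this is what
  differentiation does to a generating series of iterated integrals.\<close>

fun nc_subst :: "'v set \<Rightarrow> ('v \<Rightarrow> 'v \<Rightarrow> complex) \<Rightarrow> 'v nc_series \<Rightarrow> 'v nc_series" where
  "nc_subst V g S [] = S []"
| "nc_subst V g S (v # w) =
     (if v \<in> V then \<Sum>u\<in>V. g v u * nc_subst V g (\<lambda>x. S (u # x)) w else 0)"

lemma nc_subst_carrier: "nc_subst V g S \<in> carrier (nc_ring V)"
proof -
  have "nc_subst V g S w = 0" if "w \<notin> lists V" for w
    using that by (induction w arbitrary: S) auto
  then show ?thesis by (simp add: nc_ring_simps)
qed

lemma nc_subst_add: "nc_subst V g (\<lambda>x. S x + T x) w = nc_subst V g S w + nc_subst V g T w"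
  by (induction w arbitrary: S T) (auto simp: sum.distrib algebra_simps)

lemma nc_subst_smult: "nc_subst V g (\<lambda>x. c * S x) w = c * nc_subst V g S w"
  by (induction w arbitrary: S) (auto simp: sum_distrib_left algebra_simps)

lemma nc_subst_zero: "nc_subst V g (\<lambda>x. 0) w = 0"
  using nc_subst_smult[of V g 0] by simp

lemma nc_subst_sum: "nc_subst V g (\<lambda>x. \<Sum>u\<in>U. S u x) w = (\<Sum>u\<in>U. nc_subst V g (S u) w)"
  by (induction U rule: infinite_finite_induct) (simp_all add: nc_subst_zero nc_subst_add)

lemma nc_subst_one: "nc_subst V g nc_one = nc_one"
proof
  fix w show "nc_subst V g nc_one w = nc_one w"
    by (cases w) (auto simp: nc_one_def nc_subst_zero)
qed

text \<open>A substitution is multiplicative because left division by a variable is a derivation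
  relative to the constant term: this reduces both sides to shorter words.\<close>

lemma nc_subst_mult:
  "nc_subst V g (nc_mult S T) = nc_mult (nc_subst V g S) (nc_subst V g T)"
proof
  fix w show "nc_subst V g (nc_mult S T) w = nc_mult (nc_subst V g S) (nc_subst V g T) w"
  proof (induction w arbitrary: S)
    case (Cons v w)
    show ?case
    proof (cases "v \<in> V")
      case True
      then show ?thesis
        by (simp add: nc_mult_Cons nc_subst_add nc_subst_smult Cons.IH nc_mult_sum_left
            nc_mult_smult_left sum.distrib sum_distrib_left algebra_simps)
    next
      case False
      then have "nc_mult (\<lambda>x. nc_subst V g S (v # x)) (nc_subst V g T) w = 0"
        by (simp add: nc_mult_def)
      with False show ?thesis by (simp add: nc_mult_Cons)
    qed
  qed simp
qed

lemma nc_subst_compose: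
  "nc_subst V g (nc_subst V h S) w = nc_subst V (\<lambda>v x. \<Sum>u\<in>V. g v u * h u x) S w"
proof (induction w arbitrary: S)
  case (Cons v w)
  show ?case
  proof (cases "v \<in> V")
    case True
    have "nc_subst V g (\<lambda>x. nc_subst V h S (u # x)) w =
        (\<Sum>y\<in>V. h u y * nc_subst V (\<lambda>v x. \<Sum>u\<in>V. g v u * h u x) (\<lambda>x. S (y # x)) w)"
      if "u \<in> V" for u
      using that by (simp add: nc_subst_sum nc_subst_smult Cons.IH)
    then have "nc_subst V g (nc_subst V h S) (v # w) = (\<Sum>u\<in>V. \<Sum>y\<in>V. g v u * h u y *
        nc_subst V (\<lambda>v x. \<Sum>u\<in>V. g v u * h u x) (\<lambda>x. S (y # x)) w)"
      using True by (simp add: sum_distrib_left mult.assoc del: nc_subst.simps(2)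
          add: nc_subst.simps(2)[of V g])
    also have "\<dots> = nc_subst V (\<lambda>v x. \<Sum>u\<in>V. g v u * h u x) S (v # w)"
      using True by (subst sum.swap) (simp add: sum_distrib_right)
    finally show ?thesis .
  qed simp
qed simp

lemma nc_subst_id:
  assumes "finite V" "S \<in> carrier (nc_ring V)"
    and "\<And>v u. v \<in> V \<Longrightarrow> u \<in> V \<Longrightarrow> g v u = (if v = u then 1 else 0)"
  shows "nc_subst V g S = S"
proof
  fix w show "nc_subst V g S w = S w"
    using assms(2)
  proof (induction w arbitrary: S)
    case (Cons v w)
    have C: "(\<lambda>x. S (u # x)) \<in> carrier (nc_ring V)" for u
      using Cons.prems by (auto simp: nc_ring_simps)
    show ?case
    proof (cases "v \<in> V")
      case True
      have "nc_subst V g S (v # w) = (\<Sum>u\<in>V. (if v = u then 1 else 0) * S (u # w))"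
        using True assms(3) by (simp add: Cons.IH[OF C])
      also have "\<dots> = S (v # w)" using True assms(1) by (simp add: if_distribR sum.delta if_distrib cong: if_cong)
      finally show ?thesis .
    qed (use Cons.prems in \<open>auto simp: nc_ring_simps\<close>)
  qed simp
qed

lemma nc_subst_var:
  assumes "finite V" "u \<in> V"
  shows "nc_subst V g (nc_var u) = (\<lambda>w. \<Sum>v\<in>V. nc_smult (g v u) (nc_var v) w)"
proof
  fix w :: "'a list"
  consider "w = []" | v where "w = [v]" | v v' w' where "w = v # v' # w'"
    by (metis neq_Nil_conv)
  then show "nc_subst V g (nc_var u) w = (\<Sum>v\<in>V. nc_smult (g v u) (nc_var v) w)"
  proof cases
    case 2
    then show ?thesis using assms
      by (auto simp: nc_smult_def nc_var_def if_distrib sum.delta sum.delta' cong: if_cong)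
  next
    case 3
    have "(\<lambda>x. nc_var u (ua # ub # x)) = (\<lambda>x. 0)" for ua ub by (auto simp: nc_var_def)
    then show ?thesis
      by (cases "v' \<in> V") (simp_all add: 3 nc_subst_zero nc_smult_def, simp_all add: nc_var_def)
  qed (simp add: nc_smult_def nc_var_def)
qed

text \<open>Words of a given length over a finite alphabet are finite in number, so this is continuity for
  the product of the discrete topologies.\<close>

lemma nc_subst_local:
  assumes "\<And>x. x \<in> lists V \<Longrightarrow> length x = length w \<Longrightarrow> S x = T x"
  shows "nc_subst V g S w = nc_subst V g T w"
  using assms
proof (induction w arbitrary: S T)
  case (Cons v w)
  have "nc_subst V g (\<lambda>x. S (u # x)) w = nc_subst V g (\<lambda>x. T (u # x)) w" if "u \<in> V" for u
    using that by (intro Cons.IH Cons.prems) auto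
  then show ?case by simp
qed simp

lemma openin_discrete_product:
  "openin (product_topology (\<lambda>_. discrete_topology (UNIV :: 'b set)) (UNIV :: 'i set)) U \<longleftrightarrow>
    (\<forall>S\<in>U. \<exists>F. finite F \<and> (\<forall>T. (\<forall>x\<in>F. T x = S x) \<longrightarrow> T \<in> U))"
proof -
  have "(\<exists>X. finite {i. X i \<noteq> UNIV} \<and> (\<forall>i. openin (discrete_topology UNIV) (X i)) \<and> S \<in> Pi\<^sub>E UNIV X \<and> Pi\<^sub>E UNIV X \<subseteq> U)
    \<longleftrightarrow> (\<exists>F. finite F \<and> (\<forall>T. (\<forall>x\<in>F. T x = S x) \<longrightarrow> T \<in> U))" (is "?L \<longleftrightarrow> ?R") for S :: "'i \<Rightarrow> 'b" and U
  proof
    assume ?L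
    then obtain X where X: "finite {i. X i \<noteq> UNIV}" "S \<in> Pi\<^sub>E UNIV X" "Pi\<^sub>E UNIV X \<subseteq> U" by auto
    have "T \<in> U" if "\<forall>x\<in>{i. X i \<noteq> UNIV}. T x = S x" for T
    proof -
      have "T i \<in> X i" for i
        using that X(2) by (cases "X i = UNIV") (auto simp: PiE_iff)
      then show ?thesis using X(3) by (auto simp: PiE_iff)
    qed
    with X(1) show ?R by blast
  next
    assume ?R
    then obtain F where F: "finite F" "\<And>T. (\<forall>x\<in>F. T x = S x) \<Longrightarrow> T \<in> U" by blast
    have "finite {i. (if i \<in> F then {S i} else UNIV) \<noteq> UNIV}"
      by (rule finite_subset[OF _ F(1)]) auto
    moreover have "Pi\<^sub>E UNIV (\<lambda>i. if i \<in> F then {S i} else UNIV) \<subseteq> U"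
    proof
      fix T assume "T \<in> Pi\<^sub>E UNIV (\<lambda>i. if i \<in> F then {S i} else UNIV)"
      then have "T x \<in> (if x \<in> F then {S x} else UNIV)" for x by (simp add: PiE_iff)
      then have "\<forall>x\<in>F. T x = S x" by (metis singletonD)
      then show "T \<in> U" by (rule F(2))
    qed
    ultimately show ?L
      by (intro exI[of _ "\<lambda>i. if i \<in> F then {S i} else UNIV"]) (auto simp: PiE_iff)
  qed
  then show ?thesis 
    unfolding openin_product_topology_alt topspace_discrete_topology
    by (simp only: UNIV_I simp_thms ball_UNIV)
qed

lemma nc_topology_openin:
  "openin (nc_topology V) U \<longleftrightarrow> U \<subseteq> carrier (nc_ring V) \<and>
    (\<forall>S\<in>U. \<exists>F. finite F \<and> (\<forall>T\<in>carrier (nc_ring V). (\<forall>x\<in>F. T x = S x) \<longrightarrow> T \<in> U))"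
  (is "_ \<longleftrightarrow> ?R")
proof
  assume "openin (nc_topology V) U"
  then obtain W where W: "U = W \<inter> carrier (nc_ring V)"
    "\<forall>S\<in>W. \<exists>F. finite F \<and> (\<forall>T. (\<forall>x\<in>F. T x = S x) \<longrightarrow> T \<in> W)"
    unfolding nc_topology_def openin_subtopology openin_discrete_product by blast
  show ?R
  proof (intro conjI ballI)
    fix S assume "S \<in> U"
    then obtain F where "finite F" "\<forall>T. (\<forall>x\<in>F. T x = S x) \<longrightarrow> T \<in> W"
      using W by (metis IntD1)
    then show "\<exists>F. finite F \<and> (\<forall>T\<in>carrier (nc_ring V). (\<forall>x\<in>F. T x = S x) \<longrightarrow> T \<in> U)"
      using W(1) by (intro exI[of _ F]) simp
  qed (use W(1) in simp)
next
  assume R: ?R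
  define W where "W = {T. \<exists>S F. S \<in> U \<and> finite F \<and> (\<forall>x\<in>F. T x = S x) \<and>
    (\<forall>T\<in>carrier (nc_ring V). (\<forall>x\<in>F. T x = S x) \<longrightarrow> T \<in> U)}"
  have "U = W \<inter> carrier (nc_ring V)"
  proof (intro equalityI subsetI)
    fix S assume S: "S \<in> U"
    with R obtain F where "finite F" "\<forall>T\<in>carrier (nc_ring V). (\<forall>x\<in>F. T x = S x) \<longrightarrow> T \<in> U"
      by meson
    with S have "S \<in> W" unfolding W_def by fastforce
    with S R show "S \<in> W \<inter> carrier (nc_ring V)" by auto
  qed (auto simp: W_def)
  moreover have "\<exists>F. finite F \<and> (\<forall>T'. (\<forall>x\<in>F. T' x = T x) \<longrightarrow> T' \<in> W)" if T: "T \<in> W" for T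
  proof -
    obtain S F where F: "S \<in> U" "finite F" "\<forall>x\<in>F. T x = S x"
      "\<forall>T\<in>carrier (nc_ring V). (\<forall>x\<in>F. T x = S x) \<longrightarrow> T \<in> U"
      using T unfolding W_def by blast
    then have "T' \<in> W" if "\<forall>x\<in>F. T' x = T x" for T'
      using that unfolding W_def by force
    with F(2) show ?thesis by blast
  qed
  ultimately show "openin (nc_topology V) U"
    unfolding nc_topology_def openin_subtopology openin_discrete_product by blast
qed

lemma topspace_nc_topology: "topspace (nc_topology V) = carrier (nc_ring V)"
  by (simp add: nc_topology_def)

lemma continuous_nc_subst:
  assumes "finite V"
  shows "continuous_map (nc_topology V) (nc_topology V) (nc_subst V g)"
  unfolding continuous_map_def topspace_nc_topology
proof (intro conjI allI impI)
  show "nc_subst V g \<in> carrier (nc_ring V) \<rightarrow> carrier (nc_ring V)"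
    using nc_subst_carrier by auto
  fix U assume U: "openin (nc_topology V) U"
  show "openin (nc_topology V) {x \<in> carrier (nc_ring V). nc_subst V g x \<in> U}"
    unfolding nc_topology_openin
  proof (intro conjI ballI)
    fix S assume S: "S \<in> {x \<in> carrier (nc_ring V). nc_subst V g x \<in> U}"
    then obtain F where F: "finite F"
      "\<forall>T\<in>carrier (nc_ring V). (\<forall>x\<in>F. T x = nc_subst V g S x) \<longrightarrow> T \<in> U"
      using U unfolding nc_topology_openin by blast
    define F' where "F' = (\<Union>w\<in>F. {x. set x \<subseteq> V \<and> length x = length w})"
    have "finite F'" unfolding F'_def using F(1) finite_lists_length_eq[OF assms] by auto
    moreover have "nc_subst V g T \<in> U" if "\<forall>x\<in>F'. T x = S x" for T
    proof -
      have "nc_subst V g T w = nc_subst V g S w" if "w \<in> F" for w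
        using that \<open>\<forall>x\<in>F'. T x = S x\<close> by (intro nc_subst_local) (auto simp: F'_def)
      then show ?thesis using F(2) nc_subst_carrier by blast
    qed
    ultimately show "\<exists>F. finite F \<and> (\<forall>T\<in>carrier (nc_ring V). (\<forall>x\<in>F. T x = S x) \<longrightarrow>
        T \<in> {x \<in> carrier (nc_ring V). nc_subst V g x \<in> U})" by blast
  qed auto
qed

lemma cont_alg_automorphism_nc_subst:
  assumes fin: "finite V"
    and gh: "\<And>v u. v \<in> V \<Longrightarrow> u \<in> V \<Longrightarrow> (\<Sum>x\<in>V. g v x * h x u) = (if v = u then 1 else 0)"
    and hg: "\<And>v u. v \<in> V \<Longrightarrow> u \<in> V \<Longrightarrow> (\<Sum>x\<in>V. h v x * g x u) = (if v = u then 1 else 0)"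
  shows "cont_alg_automorphism V (nc_subst V g)"
  unfolding cont_alg_automorphism_def
proof (intro conjI allI ballI)
  have inv: "nc_subst V h (nc_subst V g S) = S" "nc_subst V g (nc_subst V h S) = S"
    if "S \<in> carrier (nc_ring V)" for S
    using nc_subst_id[OF fin that hg] nc_subst_id[OF fin that gh]
    by (auto simp: fun_eq_iff nc_subst_compose)
  have "bij_betw (nc_subst V g) (carrier (nc_ring V)) (carrier (nc_ring V))"
    by (rule bij_betwI[of _ _ _ "nc_subst V h"]) (auto simp: nc_subst_carrier inv)
  then show "nc_subst V g \<in> ring_iso (nc_ring V) (nc_ring V)"
    unfolding ring_iso_def ring_hom_def mem_Collect_eq nc_ring_simps(2-4) nc_subst_mult nc_subst_one
    by (intro conjI ballI allI impI funcsetI nc_subst_carrier ext nc_subst_add refl)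
  show "continuous_map (nc_topology V) (nc_topology V) (nc_subst V g)"
    by (rule continuous_nc_subst[OF fin])
  show "nc_subst V g (nc_smult c S) = nc_smult c (nc_subst V g S)" for c S
    by (simp add: nc_smult_def nc_subst_smult fun_eq_iff)
qed

text \<open>Noncommutative polynomials are dense, so a continuous automorphism is determined by its
  values on the variables.\<close>

lemma cont_alg_automorphism_unique:
  assumes fin: "finite V" and \<phi>: "cont_alg_automorphism V \<phi>"
    and var: "\<And>u. u \<in> V \<Longrightarrow> \<phi> (nc_var u) = nc_subst V g (nc_var u)"
    and S: "S \<in> carrier (nc_ring V)"
  shows "\<phi> S = nc_subst V g S"
proof -
  let ?R = "carrier (nc_ring V)"
  have hom: "\<phi> \<in> ring_hom (nc_ring V) (nc_ring V)"
    and sm: "\<And>c S. S \<in> ?R \<Longrightarrow> \<phi> (nc_smult c S) = nc_smult c (\<phi> S)"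
    and cont: "continuous_map (nc_topology V) (nc_topology V) \<phi>"
    using \<phi> by (simp_all add: cont_alg_automorphism_def ring_iso_def)
  have mult: "\<phi> (nc_mult S T) = nc_mult (\<phi> S) (\<phi> T)" 
    and add: "\<phi> (\<lambda>w. S w + T w) = (\<lambda>w. \<phi> S w + \<phi> T w)"
    if "S \<in> ?R" "T \<in> ?R" for S T
    using ring_hom_mult[OF hom that] ring_hom_add[OF hom that] by (simp_all add: nc_ring_simps)
  have one: "\<phi> nc_one = nc_one"
    using ring_hom_one[OF hom] by (simp add: nc_ring_simps)
  define mon :: "'a list \<Rightarrow> 'a nc_series" where "mon x = (\<lambda>w. if w = x then 1 else 0)" for x
  have mon_carrier: "mon x \<in> ?R" if "x \<in> lists V" for x
    using that by (auto simp: mon_def nc_ring_simps)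
  have mon_Cons: "mon (v # x) = nc_mult (nc_var v) (mon x)" for v x
  proof
    fix w show "mon (v # x) w = nc_mult (nc_var v) (mon x) w"
    proof (cases w)
      case (Cons u w')
      have "nc_mult (\<lambda>x. nc_var v (u # x)) (mon x) w' = (if u = v then mon x w' else 0)"
      proof (cases "u = v")
        case True
        then have "(\<lambda>x. nc_var v (u # x)) = nc_one" by (auto simp: nc_var_def nc_one_def)
        then show ?thesis using True by simp
      qed (auto simp: nc_mult_def nc_var_def)
      then show ?thesis by (auto simp: Cons nc_mult_Cons nc_var_def mon_def)
    qed (auto simp: mon_def nc_var_def)
  qed
  have mon_eq: "\<phi> (mon x) = nc_subst V g (mon x)" if "x \<in> lists V" for x
    using that
  proof (induction x)
    case Nil
    have "mon [] = nc_one" by (auto simp: mon_def nc_one_def)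
    then show ?case using one by (simp add: nc_subst_one)
  next
    case (Cons v x)
    moreover have v: "v \<in> V" "x \<in> lists V"
      using Cons.hyps by auto
    moreover have "nc_var v \<in> ?R" using v(1) by (auto simp: nc_var_def nc_ring_simps)
    ultimately show ?case by (simp add: mon_Cons mult mon_carrier nc_subst_mult var)
  qed
  have poly: "\<phi> T = nc_subst V g T" if "finite F" "T \<in> ?R" "\<And>x. x \<notin> F \<Longrightarrow> T x = 0" for F T
    using that
  proof (induction F arbitrary: T rule: finite_induct)
    case empty
    have "\<phi> (nc_smult 0 nc_one) = nc_smult 0 (\<phi> nc_one)"
      by (rule sm) (auto simp: nc_ring_simps nc_one_def)
    moreover have "T = nc_smult 0 nc_one" using empty by (auto simp: nc_smult_def)
    moreover have "nc_subst V g (\<lambda>x. 0) = (\<lambda>w. 0)" by (simp add: fun_eq_iff nc_subst_zero)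
    ultimately show ?case by (simp add: one nc_smult_def)
  next
    case (insert x F)
    define T' where "T' = T(x := 0)"
    have T': "T' \<in> ?R" using insert.prems by (auto simp: T'_def nc_ring_simps)
    have IH: "\<phi> T' = nc_subst V g T'"
      by (rule insert.IH[OF T']) (use insert.prems in \<open>auto simp: T'_def\<close>)
    show ?case
    proof (cases "x \<in> lists V")
      case True
      define c where "c = T x"
      have T_eq: "T = (\<lambda>w. T' w + nc_smult c (mon x) w)"
        by (auto simp: T'_def nc_smult_def mon_def c_def)
      have C: "nc_smult c (mon x) \<in> ?R"
        using mon_carrier[OF True] by (auto simp: nc_smult_def nc_ring_simps)
      have "\<phi> T = (\<lambda>w. nc_subst V g T' w + nc_smult c (nc_subst V g (mon x)) w)"
        unfolding T_eq add[OF T' C] IH sm[OF mon_carrier[OF True]] mon_eq[OF True] ..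
      also have "\<dots> = nc_subst V g (\<lambda>w. T' w + nc_smult c (mon x) w)"
        by (auto simp: nc_subst_add nc_smult_def nc_subst_smult)
      finally show ?thesis unfolding T_eq[symmetric] .
    next
      case False
      then have "T x = 0" using insert.prems(1) unfolding nc_ring_simps by blast
      then have "T = T'" by (simp add: T'_def fun_upd_idem)
      with IH show ?thesis by simp
    qed
  qed
  show ?thesis
  proof
    fix w
    have "openin (nc_topology V) {T \<in> ?R. T w = \<phi> S w}"
      unfolding nc_topology_openin by (auto intro!: exI[of _ "{w}"])
    then have "openin (nc_topology V) {T \<in> ?R. \<phi> T \<in> {T \<in> ?R. T w = \<phi> S w}}"
      using cont unfolding continuous_map_def topspace_nc_topology by blast
    then have "\<forall>S'\<in>{T \<in> ?R. \<phi> T \<in> {T \<in> ?R. T w = \<phi> S w}}. \<exists>F. finite F \<and>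
        (\<forall>T\<in>?R. (\<forall>x\<in>F. T x = S' x) \<longrightarrow> T \<in> {T \<in> ?R. \<phi> T \<in> {T \<in> ?R. T w = \<phi> S w}})"
      unfolding nc_topology_openin by (rule conjunct2)
    from bspec[OF this, of S] obtain F where F: "finite F"
      "\<And>T. T \<in> ?R \<Longrightarrow> (\<forall>x\<in>F. T x = S x) \<Longrightarrow> \<phi> T w = \<phi> S w"
      using S ring_hom_closed[OF hom S] by auto
    define F' where "F' = F \<union> {x. set x \<subseteq> V \<and> length x = length w}"
    \<comment> \<open>\<open>T\<close> is a polynomial that neither \<open>\<phi>\<close> nor the substitution tells apart from \<open>S\<close> at the word \<open>w\<close>\<close>
    define T where "T = (\<lambda>x. if x \<in> F' then S x else 0)"
    have T: "T \<in> ?R" using S by (auto simp: T_def nc_ring_simps)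
    have "\<phi> S w = \<phi> T w" using F(2)[OF T] by (auto simp: T_def F'_def)
    also have "\<phi> T = nc_subst V g T"
      using F(1) finite_lists_length_eq[OF fin] T
      by (intro poly[of F']) (auto simp: F'_def T_def)
    also have "nc_subst V g T w = nc_subst V g S w"
      by (rule nc_subst_local) (auto simp: T_def F'_def)
    finally show "\<phi> S w = nc_subst V g S w" .
  qed
qed

section \<open>The modular group and neighbourhoods of cusps\<close>

lemma SL2Z_iff: "A \<in> carrier SL2Z \<longleftrightarrow> A $ 1 $ 1 * A $ 2 $ 2 - A $ 1 $ 2 * A $ 2 $ 1 = 1"
  by (simp add: SL2Z_def det_2)

lemma SL2Z_mult [simp]: "A \<otimes>\<^bsub>SL2Z\<^esub> B = A ** B"
  by (simp add: SL2Z_def)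

lemma SL2Z_one [simp]: "\<one>\<^bsub>SL2Z\<^esub> = mat 1"
  by (simp add: SL2Z_def)

lemma matrix_mult_2:
  fixes A B :: "int^2^2"
  shows "(A ** B) $ i $ j = A $ i $ 1 * B $ 1 $ j + A $ i $ 2 * B $ 2 $ j"
  by (simp add: matrix_matrix_mult_def sum_2)

lemma mat_2: "(mat 1 :: int^2^2) $ 1 $ 1 = 1" "(mat 1 :: int^2^2) $ 1 $ 2 = 0"
  "(mat 1 :: int^2^2) $ 2 $ 1 = 0" "(mat 1 :: int^2^2) $ 2 $ 2 = 1"
  by (simp_all add: mat_def)

definition mk_mat :: "int \<Rightarrow> int \<Rightarrow> int \<Rightarrow> int \<Rightarrow> int^2^2" where
  "mk_mat a b c d = vector [vector [a, b], vector [c, d]]"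

lemma mk_mat_nth [simp]: "mk_mat a b c d $ 1 $ 1 = a" "mk_mat a b c d $ 1 $ 2 = b"
  "mk_mat a b c d $ 2 $ 1 = c" "mk_mat a b c d $ 2 $ 2 = d"
  by (simp_all add: mk_mat_def)

lemma mat_eq_2: "(A :: int^2^2) = B \<longleftrightarrow> A $ 1 $ 1 = B $ 1 $ 1 \<and> A $ 1 $ 2 = B $ 1 $ 2 \<and>
    A $ 2 $ 1 = B $ 2 $ 1 \<and> A $ 2 $ 2 = B $ 2 $ 2"
  unfolding vec_eq_iff forall_2 by blast

definition adj :: "int^2^2 \<Rightarrow> int^2^2" where
  "adj A = mk_mat (A $ 2 $ 2) (- A $ 1 $ 2) (- A $ 2 $ 1) (A $ 1 $ 1)"

lemma adj_SL2Z:
  assumes "A \<in> carrier SL2Z"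
  shows "adj A \<in> carrier SL2Z" "adj A ** A = mat 1" "A ** adj A = mat 1"
  using assms by (auto simp: SL2Z_iff adj_def mat_eq_2 matrix_mult_2 mat_2 algebra_simps)

lemma SL2Z_mult_closed: "A \<in> carrier SL2Z \<Longrightarrow> B \<in> carrier SL2Z \<Longrightarrow> A ** B \<in> carrier SL2Z"
  by (simp add: SL2Z_def det_mul)

lemma group_SL2Z: "group SL2Z"
proof (rule groupI)
  show "\<exists>y\<in>carrier SL2Z. y \<otimes>\<^bsub>SL2Z\<^esub> x = \<one>\<^bsub>SL2Z\<^esub>" if "x \<in> carrier SL2Z" for x
    using adj_SL2Z[OF that] by auto
qed (auto simp: SL2Z_mult_closed matrix_mul_assoc, simp add: SL2Z_iff mat_2)

lemma SL2Z_inv: "A \<in> carrier SL2Z \<Longrightarrow> inv\<^bsub>SL2Z\<^esub> A = adj A"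
  by (rule group.inv_equality[OF group_SL2Z]) (auto simp: adj_SL2Z)

abbreviation uhp :: "complex set" where "uhp \<equiv> upper_half_plane"

lemma uhp_iff: "z \<in> uhp \<longleftrightarrow> Im z > 0"
  by (simp add: upper_half_plane_def)

lemma open_uhp: "open uhp"
  by (simp add: upper_half_plane_def open_halfspace_Im_gt)

lemma convex_uhp: "convex uhp"
  by (simp add: upper_half_plane_def convex_halfspace_Im_gt)

lemma SL2Z_det_complex:
  assumes "A \<in> carrier SL2Z"
  shows "(of_int (A $ 1 $ 1) * of_int (A $ 2 $ 2) - of_int (A $ 1 $ 2) * of_int (A $ 2 $ 1)
    :: 'a :: ring_1) = 1"
  using arg_cong[OF assms[unfolded SL2Z_iff], of "of_int :: int \<Rightarrow> 'a"] by simp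

lemma aut_factor_nonzero:
  assumes "A \<in> carrier SL2Z" "z \<in> uhp"
  shows "aut_factor A z \<noteq> 0"
proof
  assume 0: "aut_factor A z = 0"
  then have "of_int (A $ 2 $ 1) * Im z = 0"
    by (auto simp: aut_factor_def complex_eq_iff)
  then have "A $ 2 $ 1 = 0" using assms by (auto simp: uhp_iff)
  with 0 have "A $ 2 $ 2 = 0" by (simp add: aut_factor_def)
  with \<open>A $ 2 $ 1 = 0\<close> show False using assms by (simp add: SL2Z_iff)
qed

lemma Im_frac_lin:
  assumes "A \<in> carrier SL2Z"
  shows "Im (frac_lin A z) = Im z / (cmod (aut_factor A z))\<^sup>2"
proof -
  have *: "real_of_int (A $ 1 $ 1) * real_of_int (A $ 2 $ 2)
      - real_of_int (A $ 1 $ 2) * real_of_int (A $ 2 $ 1) = 1"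
    by (rule SL2Z_det_complex[OF assms])
  have "Im (frac_lin A z) = (real_of_int (A $ 1 $ 1) * real_of_int (A $ 2 $ 2)
      - real_of_int (A $ 1 $ 2) * real_of_int (A $ 2 $ 1)) * Im z / (cmod (aut_factor A z))\<^sup>2"
    unfolding frac_lin_def by (simp add: Im_divide cmod_power2 aut_factor_def algebra_simps)
  then show ?thesis using * by simp
qed

lemma frac_lin_uhp: "A \<in> carrier SL2Z \<Longrightarrow> z \<in> uhp \<Longrightarrow> frac_lin A z \<in> uhp"
  using aut_factor_nonzero[of A z] by (simp add: uhp_iff Im_frac_lin)

lemma aut_factor_mult:
  assumes "B \<in> carrier SL2Z" "z \<in> uhp"
  shows "aut_factor (A ** B) z = aut_factor A (frac_lin B z) * aut_factor B z"
proof -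
  have "aut_factor A (frac_lin B z) * aut_factor B z = of_int (A $ 2 $ 1) *
      (of_int (B $ 1 $ 1) * z + of_int (B $ 1 $ 2)) + of_int (A $ 2 $ 2) * aut_factor B z"
    using aut_factor_nonzero[OF assms]
    by (simp add: aut_factor_def[of A] frac_lin_def distrib_right)
  also have "\<dots> = aut_factor (A ** B) z"
    by (simp add: aut_factor_def matrix_mult_2 algebra_simps)
  finally show ?thesis ..
qed

lemma frac_lin_mult:
  assumes "A \<in> carrier SL2Z" "B \<in> carrier SL2Z" "z \<in> uhp"
  shows "frac_lin (A ** B) z = frac_lin A (frac_lin B z)"
proof -
  let ?n = "\<lambda>A z. of_int (A $ 1 $ 1) * z + of_int (A $ 1 $ 2) :: complex"
  have B: "aut_factor B z \<noteq> 0" by (rule aut_factor_nonzero[OF assms(2,3)])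
  have "?n (A ** B) z = ?n A (frac_lin B z) * aut_factor B z"
    using B by (simp add: frac_lin_def field_simps) (simp add: aut_factor_def matrix_mult_2 algebra_simps)
  then show ?thesis
    using B unfolding frac_lin_def[of "A ** B"] aut_factor_mult[OF assms(2,3)]
    by (simp add: frac_lin_def[of A])
qed

lemma frac_lin_one [simp]: "frac_lin (mat 1) z = z"
  by (simp add: frac_lin_def aut_factor_def mat_2)

lemma frac_lin_adj:
  assumes "A \<in> carrier SL2Z" "z \<in> uhp"
  shows "frac_lin A (frac_lin (adj A) z) = z" "frac_lin (adj A) (frac_lin A z) = z"
  using assms by (simp_all add: frac_lin_mult[symmetric] adj_SL2Z)

lemma frac_lin_deriv:
  assumes "A \<in> carrier SL2Z" "z \<in> uhp"
  shows "(frac_lin A has_field_derivative 1 / aut_factor A z ^ 2) (at z)"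
proof -
  have nz: "of_int (A $ 2 $ 1) * z + of_int (A $ 2 $ 2) \<noteq> 0"
    using aut_factor_nonzero[OF assms] by (simp add: aut_factor_def)
  have "((\<lambda>z. (of_int (A $ 1 $ 1) * z + of_int (A $ 1 $ 2)) / (of_int (A $ 2 $ 1) * z + of_int (A $ 2 $ 2)))
    has_field_derivative
      (of_int (A $ 1 $ 1) * (of_int (A $ 2 $ 1) * z + of_int (A $ 2 $ 2)) -
       (of_int (A $ 1 $ 1) * z + of_int (A $ 1 $ 2)) * of_int (A $ 2 $ 1)) /
       ((of_int (A $ 2 $ 1) * z + of_int (A $ 2 $ 2)) * (of_int (A $ 2 $ 1) * z + of_int (A $ 2 $ 2)))) (at z)"
    using nz by (auto intro!: derivative_eq_intros)
  also have "of_int (A $ 1 $ 1) * (of_int (A $ 2 $ 1) * z + of_int (A $ 2 $ 2)) -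
       (of_int (A $ 1 $ 1) * z + of_int (A $ 1 $ 2)) * of_int (A $ 2 $ 1) =
       of_int (A $ 1 $ 1) * of_int (A $ 2 $ 2) - of_int (A $ 1 $ 2) * of_int (A $ 2 $ 1)"
    by (simp add: algebra_simps)
  also have "\<dots> = 1" by (rule SL2Z_det_complex[OF assms(1)])
  finally show ?thesis
    by (simp add: frac_lin_def[abs_def] aut_factor_def power2_eq_square)
qed

lemma deriv_frac_lin:
  "A \<in> carrier SL2Z \<Longrightarrow> z \<in> uhp \<Longrightarrow> deriv (frac_lin A) z = 1 / aut_factor A z ^ 2"
  by (rule DERIV_imp_deriv[OF frac_lin_deriv])

text \<open>In homogeneous coordinates \<open>[p : q]\<close> the action on the projective line is matrix
  multiplication; this disposes of the case distinctions in \<open>cusp_act\<close>.\<close>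

definition cusp_of :: "int \<Rightarrow> int \<Rightarrow> cusp" where
  "cusp_of p q = (if q = 0 then Cusp_Infinity else Cusp (of_int p / of_int q))"

lemma cusp_act_cusp_of:
  assumes "A \<in> carrier SL2Z" "p \<noteq> 0 \<or> q \<noteq> 0"
  shows "cusp_act A (cusp_of p q) =
    cusp_of (A $ 1 $ 1 * p + A $ 1 $ 2 * q) (A $ 2 $ 1 * p + A $ 2 $ 2 * q)"
proof (cases "q = 0")
  case True
  with assms show ?thesis by (auto simp: cusp_of_def)
next
  case False
  have *: "of_int x * (of_int p / of_int q) + of_int y = (of_int (x * p + y * q) / of_int q :: rat)" for x y
    using False by (simp add: field_simps)
  have **: "of_int x / of_int q = (0 :: rat) \<longleftrightarrow> x = 0" for x
    using False by simp
  show ?thesis using False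
    by (simp only: cusp_of_def if_False cusp_act.simps * ** if_True)
      (simp del: of_int_add of_int_mult)
qed

lemma cusp_act_Infinity: "cusp_act A Cusp_Infinity = cusp_of (A $ 1 $ 1) (A $ 2 $ 1)"
  by (simp add: cusp_of_def)

lemma SL2Z_column_nonzero: "A \<in> carrier SL2Z \<Longrightarrow> A $ 1 $ 1 \<noteq> 0 \<or> A $ 2 $ 1 \<noteq> 0"
  by (auto simp: SL2Z_iff)

text \<open>By Bezout, numerator and denominator of a reduced fraction form the first column of a matrix
  of determinant \<open>1\<close>.\<close>

lemma cusp_transitive:
  obtains A where "A \<in> carrier SL2Z" "cusp_act A Cusp_Infinity = b"
proof (cases b)
  case Cusp_Infinity
  then show ?thesis using that[of "mat 1"] by (simp add: SL2Z_iff mat_2)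
next
  case (Cusp x)
  obtain p q where pq: "quotient_of x = (p, q)" by fastforce
  obtain u v where "u * p + v * q = 1"
    using bezout_int[of p q] quotient_of_coprime[OF pq] by auto
  then have "mk_mat p (- v) q u \<in> carrier SL2Z" by (simp add: SL2Z_iff algebra_simps)
  moreover have "cusp_act (mk_mat p (- v) q u) Cusp_Infinity = b"
    using quotient_of_div[OF pq] quotient_of_denom_pos[OF pq] Cusp by simp
  ultimately show ?thesis by (rule that)
qed

lemma cusp_act_mult:
  assumes "A \<in> carrier SL2Z" "B \<in> carrier SL2Z"
  shows "cusp_act (A ** B) b = cusp_act A (cusp_act B b)"
proof -
  obtain C where C: "C \<in> carrier SL2Z" "cusp_act C Cusp_Infinity = b" by (rule cusp_transitive)
  note nz = SL2Z_column_nonzero[OF C(1)] SL2Z_column_nonzero[OF SL2Z_mult_closed[OF assms(2) C(1)]]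
  show ?thesis using nz
    by (simp add: C(2)[symmetric] cusp_act_Infinity cusp_act_cusp_of assms SL2Z_mult_closed
        matrix_mult_2 del: cusp_act.simps) (simp add: algebra_simps)
qed

lemma cusp_act_one: "cusp_act (mat 1) b = b"
  by (cases b) (simp_all add: mat_2)

text \<open>The stabilizer of infinity consists of triangular matrices with diagonal \<open>\<plusminus>1\<close>, which act as
  integral translations.\<close>

lemma cusp_act_Infinity_eq:
  assumes "A \<in> carrier SL2Z" "B \<in> carrier SL2Z" "cusp_act A Cusp_Infinity = cusp_act B Cusp_Infinity"
  obtains n :: int where "\<And>z. z \<in> uhp \<Longrightarrow> frac_lin A z = frac_lin B (z + of_int n)"
proof -
  define C where "C = adj B ** A"
  have C: "C \<in> carrier SL2Z" unfolding C_def by (intro SL2Z_mult_closed adj_SL2Z assms)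
  have A: "A = B ** C" unfolding C_def using adj_SL2Z(3)[OF assms(2)] by (simp add: matrix_mul_assoc)
  have "cusp_act C Cusp_Infinity = cusp_act (adj B) (cusp_act B Cusp_Infinity)"
    unfolding C_def assms(3)[symmetric] by (rule cusp_act_mult[OF adj_SL2Z(1)[OF assms(2)] assms(1)])
  also have "\<dots> = Cusp_Infinity"
    using cusp_act_mult[OF adj_SL2Z(1)[OF assms(2)] assms(2)] adj_SL2Z(2)[OF assms(2)]
    by (metis cusp_act_one)
  finally have C21: "C $ 2 $ 1 = 0" by (auto split: if_splits)
  then have d: "C $ 1 $ 1 * C $ 2 $ 2 = 1" using C by (simp add: SL2Z_iff)
  then have "(C $ 1 $ 1 = 1 \<and> C $ 2 $ 2 = 1) \<or> (C $ 1 $ 1 = -1 \<and> C $ 2 $ 2 = -1)"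
    by (simp add: zmult_eq_1_iff)
  then have "frac_lin C z = z + of_int (C $ 1 $ 2 * C $ 2 $ 2)" for z
    using C21 by (auto simp: frac_lin_def aut_factor_def)
  then have "frac_lin A z = frac_lin B (z + of_int (C $ 1 $ 2 * C $ 2 $ 2))" if "z \<in> uhp" for z
    using that by (simp add: A frac_lin_mult[OF assms(2) C])
  then show ?thesis by (rule that)
qed

text \<open>Approach to infinity within vertical strips.  The restriction on \<open>Re z\<close> serves to bound the
  factors \<open>a z + b\<close> and \<open>c z + d\<close> of the integrands in terms of \<open>Im z\<close> alone; all strips are
  used at once because translations, which stabilize the cusp, move a single strip.\<close>

definition cusp_strip :: "complex filter" where
  "cusp_strip = (SUP K. inf (filtercomap Im at_top) (principal {z. \<bar>Re z\<bar> \<le> K}))"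

lemma eventually_cusp_strip:
  "eventually P cusp_strip \<longleftrightarrow> (\<forall>K. \<exists>Y. \<forall>z. \<bar>Re z\<bar> \<le> K \<longrightarrow> Im z \<ge> Y \<longrightarrow> P z)"
  unfolding cusp_strip_def eventually_Sup
  by (simp add: eventually_inf_principal eventually_filtercomap_at_top_linorder)
     (intro iff_allI ex_cong1 all_cong1, blast)

lemma eventually_cusp_stripI:
  "(\<And>K. K \<ge> 0 \<Longrightarrow> \<exists>Y. \<forall>z. \<bar>Re z\<bar> \<le> K \<longrightarrow> Im z \<ge> Y \<longrightarrow> P z) \<Longrightarrow> eventually P cusp_strip"
  unfolding eventually_cusp_strip by (metis abs_ge_zero order.trans linear)

lemma cusp_strip_neq_bot: "cusp_strip \<noteq> bot"
proof
  assume "cusp_strip = bot"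
  then have "eventually (\<lambda>_. False) cusp_strip" by simp
  then obtain Y where "\<forall>z. \<bar>Re z\<bar> \<le> 0 \<longrightarrow> Im z \<ge> Y \<longrightarrow> False"
    unfolding eventually_cusp_strip by blast
  from this[rule_format, of "Complex 0 Y"] show False by simp
qed

lemma eventually_cusp_strip_uhp: "eventually (\<lambda>z. z \<in> uhp) cusp_strip"
  unfolding eventually_cusp_strip uhp_iff by (intro allI exI[of _ 1]) auto

lemma eventually_cusp_strip_shift:
  "eventually (\<lambda>z. P (z + of_int n)) cusp_strip \<longleftrightarrow> eventually P cusp_strip"
proof -
  have *: "eventually (\<lambda>z. P (z + of_int n)) cusp_strip" if "eventually P cusp_strip" for P n
    unfolding eventually_cusp_strip
  proof
    fix K
    from spec[OF that[unfolded eventually_cusp_strip], of "K + \<bar>of_int n\<bar>"]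
    obtain Y where "\<forall>z. \<bar>Re z\<bar> \<le> K + \<bar>of_int n\<bar> \<longrightarrow> Im z \<ge> Y \<longrightarrow> P z" ..
    then have "\<bar>Re z\<bar> \<le> K \<longrightarrow> Im z \<ge> Y \<longrightarrow> P (z + of_int n)" for z by auto
    then show "\<exists>Y. \<forall>z. \<bar>Re z\<bar> \<le> K \<longrightarrow> Im z \<ge> Y \<longrightarrow> P (z + of_int n)" by blast
  qed
  show ?thesis
  proof
    assume "eventually (\<lambda>z. P (z + of_int n)) cusp_strip"
    from *[OF this, of "- n"] show "eventually P cusp_strip" by simp
  qed (rule *)
qed

text \<open>The result does not depend on the chosen matrix, see \<open>cusp_nhds_eq\<close>.\<close>

definition cusp_nhds :: "cusp \<Rightarrow> complex filter" where
  "cusp_nhds b = filtermap (frac_lin (SOME A. A \<in> carrier SL2Z \<and> cusp_act A Cusp_Infinity = b)) cusp_strip"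

lemma cusp_nhds_eq:
  assumes "A \<in> carrier SL2Z"
  shows "cusp_nhds (cusp_act A Cusp_Infinity) = filtermap (frac_lin A) cusp_strip"
proof -
  define B where "B = (SOME B. B \<in> carrier SL2Z \<and> cusp_act B Cusp_Infinity = cusp_act A Cusp_Infinity)"
  have B: "B \<in> carrier SL2Z" "cusp_act B Cusp_Infinity = cusp_act A Cusp_Infinity"
    using someI[of "\<lambda>B. B \<in> carrier SL2Z \<and> cusp_act B Cusp_Infinity = cusp_act A Cusp_Infinity" A] assms
    unfolding B_def by blast+
  obtain n where n: "\<And>z. z \<in> uhp \<Longrightarrow> frac_lin B z = frac_lin A (z + of_int n)"
    using cusp_act_Infinity_eq[OF B(1) assms B(2)] by metis
  have "eventually (\<lambda>z. P (frac_lin B z)) cusp_strip \<longleftrightarrow>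
      eventually (\<lambda>z. P (frac_lin A (z + of_int n))) cusp_strip" for P
    by (rule eventually_cong[OF eventually_cusp_strip_uhp]) (simp add: n)
  then show ?thesis
    unfolding cusp_nhds_def B_def[symmetric] filter_eq_iff eventually_filtermap
    using eventually_cusp_strip_shift[of "\<lambda>z. _ (frac_lin A z)"] by simp
qed

lemma cusp_nhds_act:
  assumes "A \<in> carrier SL2Z"
  shows "cusp_nhds (cusp_act A b) = filtermap (frac_lin A) (cusp_nhds b)"
proof -
  obtain C where C: "C \<in> carrier SL2Z" "cusp_act C Cusp_Infinity = b" by (rule cusp_transitive)
  have "cusp_nhds (cusp_act A b) = filtermap (frac_lin (A ** C)) cusp_strip"
    using cusp_nhds_eq[OF SL2Z_mult_closed[OF assms C(1)]] cusp_act_mult[OF assms C(1)] C(2) by metis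
  also have "\<dots> = filtermap (\<lambda>z. frac_lin A (frac_lin C z)) cusp_strip"
    unfolding filter_eq_iff eventually_filtermap
    by (intro allI eventually_cong[OF eventually_cusp_strip_uhp]) (simp add: frac_lin_mult assms C)
  finally show ?thesis
    using cusp_nhds_eq[OF C(1)] C(2) by (simp add: filtermap_filtermap)
qed

lemma cusp_nhds_neq_bot: "cusp_nhds b \<noteq> bot"
  by (simp add: cusp_nhds_def filtermap_bot_iff cusp_strip_neq_bot)

lemma eventually_cusp_nhds_uhp: "eventually (\<lambda>z. z \<in> uhp) (cusp_nhds b)"
proof -
  obtain C where C: "C \<in> carrier SL2Z" "cusp_act C Cusp_Infinity = b" by (rule cusp_transitive)
  have "eventually (\<lambda>z. z \<in> uhp) (filtermap (frac_lin C) cusp_strip)"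
    using eventually_cusp_strip_uhp unfolding eventually_filtermap
    by eventually_elim (rule frac_lin_uhp[OF C(1)])
  then show ?thesis using cusp_nhds_eq[OF C(1)] C(2) by simp
qed

section \<open>Decay of cusp forms\<close>

lemma periodic_int:
  fixes F :: "complex \<Rightarrow> 'a"
  assumes per: "\<And>z. z \<in> uhp \<Longrightarrow> F (z + of_real N) = F z" and z: "z \<in> uhp"
  shows "F (z + of_real N * of_int n) = F z"
proof -
  have nat: "F (z + of_real N * of_nat k) = F z" if "z \<in> uhp" for k z
  proof (induction k)
    case (Suc k)
    have "F (z + of_real N * of_nat (Suc k)) = F ((z + of_real N * of_nat k) + of_real N)"
      by (simp add: algebra_simps)
    also have "\<dots> = F z" using that Suc by (subst per) (auto simp: uhp_iff)
    finally show ?case .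
  qed simp
  show ?thesis
  proof (cases n)
    case (nonneg k)
    then show ?thesis using nat[OF z, of k] by simp
  next
    case (neg k)
    have "F (z + of_real N * of_int n + of_real N * of_nat (Suc k)) = F (z + of_real N * of_int n)"
      by (rule nat) (use z in \<open>simp add: uhp_iff\<close>)
    then show ?thesis by (simp add: neg algebra_simps)
  qed
qed

text \<open>A periodic holomorphic function is a function of \<open>q = exp (2 \<pi> i z / N)\<close> on the punctured
  unit disc.  If it tends to \<open>0\<close> at infinity, the singularity at \<open>q = 0\<close> is removable with
  value \<open>0\<close>, so the function is \<open>O(q)\<close>.\<close>

lemma periodic_exp_decay:
  fixes F :: "complex \<Rightarrow> complex"
  assumes hol: "F holomorphic_on uhp" and N: "N > 0"
    and per: "\<And>z. z \<in> uhp \<Longrightarrow> F (z + of_real N) = F z"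
    and lim: "(F \<longlongrightarrow> 0) (filtercomap Im at_top)"
  obtains C Y where "\<And>z. Im z \<ge> Y \<Longrightarrow> cmod (F z) \<le> C * exp (- (2 * pi / N) * Im z)"
proof -
  \<comment> \<open>\<open>w \<mapsto> \<kappa> w\<close> is inverse to \<open>z \<mapsto> 2 \<pi> i z / N\<close>, so \<open>g\<close> is \<open>F\<close> in the coordinate \<open>q\<close>;
    by periodicity, \<open>g\<close> is insensitive to the branch of the logarithm\<close>
  define \<kappa> :: complex where "\<kappa> = - \<i> * of_real (N / (2 * pi))"
  have Im_\<kappa>: "Im (\<kappa> * w) = - N / (2 * pi) * Re w" for w by (simp add: \<kappa>_def)
  define g where "g q = (if q = 0 then 0 else F (\<kappa> * Ln q))" for q
  have \<kappa>_uhp: "\<kappa> * w \<in> uhp" if "cmod (exp w) < 1" for w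
  proof -
    have "Re w < 0" using that by simp
    then have "N / (2 * pi) * Re w < 0" using N by (intro mult_pos_neg) auto
    then show ?thesis by (simp add: uhp_iff Im_\<kappa> del: times_complex.sel)
  qed
  have F_log: "F (\<kappa> * w) = g (exp w)" if "cmod (exp w) < 1" for w
  proof -
    have "exp w = exp (Ln (exp w))" by simp
    then obtain n where n: "w = Ln (exp w) + of_int (2 * n) * of_real pi * \<i>"
      unfolding exp_eq by auto
    have "\<kappa> * w = \<kappa> * Ln (exp w) + of_real N * of_int n"
      by (subst n) (simp add: \<kappa>_def field_simps)
    moreover have "\<kappa> * Ln (exp w) \<in> uhp"
      by (rule \<kappa>_uhp) (use that in simp)
    ultimately show ?thesis
      by (simp add: g_def periodic_int[where F = F and N = N, OF per])
  qed
  have g_diff: "g field_differentiable (at q0)" if q0: "q0 \<in> ball 0 1 - {0}" for q0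
  proof -
    have "(\<lambda>q. F (\<kappa> * (Ln q0 + Ln (q / q0)))) field_differentiable at q0"
    proof (rule field_differentiable_compose[of "\<lambda>q. \<kappa> * (Ln q0 + Ln (q / q0))" q0 F, unfolded o_def])
      show "(\<lambda>q. \<kappa> * (Ln q0 + Ln (q / q0))) field_differentiable at q0"
        using q0 unfolding field_differentiable_def
        by (auto intro!: derivative_eq_intros exI)
      show "F field_differentiable at (\<kappa> * (Ln q0 + Ln (q0 / q0)))"
        using q0 by (intro holomorphic_on_imp_differentiable_at[OF hol open_uhp] \<kappa>_uhp) simp
    qed
    then obtain D where D: "((\<lambda>q. F (\<kappa> * (Ln q0 + Ln (q / q0)))) has_field_derivative D) (at q0)"
      by (auto simp: field_differentiable_def)
    have "(g has_field_derivative D) (at q0)"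
    proof (rule has_field_derivative_transform_within_open[OF D, where S = "ball 0 1 - {0}"])
      fix q :: complex assume q: "q \<in> ball 0 1 - {0}"
      have "exp (Ln q0 + Ln (q / q0)) = q" using q q0 by (simp add: exp_add)
      then show "F (\<kappa> * (Ln q0 + Ln (q / q0))) = g q"
        using F_log[of "Ln q0 + Ln (q / q0)"] q by simp
    qed (use q0 in auto)
    then show ?thesis by (auto simp: field_differentiable_def)
  qed
  have g_lim: "(g \<longlongrightarrow> 0) (at 0)"
  proof (rule tendstoI)
    fix e :: real assume e: "e > 0"
    then obtain Y where Y: "\<And>z. Im z \<ge> Y \<Longrightarrow> cmod (F z) < e"
      using tendstoD[OF lim e] unfolding eventually_filtercomap_at_top_linorder by auto
    have "dist (g q) 0 < e" if "q \<noteq> 0" "dist q 0 < exp (- (2 * pi / N) * Y)" for q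
    proof -
      have "ln (cmod q) < - (2 * pi / N) * Y"
        using that by (metis dist_0_norm dist_commute ln_exp ln_less_cancel_iff exp_gt_zero zero_less_norm_iff)
      then have "Im (\<kappa> * Ln q) \<ge> Y"
        using that(1) N by (simp add: Im_\<kappa> field_simps del: times_complex.sel)
      then show ?thesis using Y that(1) by (simp add: g_def)
    qed
    then show "\<forall>\<^sub>F q in at 0. dist (g q) 0 < e"
      unfolding eventually_at by (intro exI[of _ "exp (- (2 * pi / N) * Y)"]) auto
  qed
  have "g holomorphic_on ball 0 1"
  proof (rule no_isolated_singularity[where K = "{0}"])
    show "continuous_on (ball 0 1) g"
    proof (rule continuous_at_imp_continuous_on, rule ballI)
      fix q :: complex assume q: "q \<in> ball 0 1"
      show "isCont g q"
      proof (cases "q = 0")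
        case True
        then show ?thesis using g_lim by (simp add: isCont_def g_def[of 0])
      qed (use q in \<open>auto intro!: field_differentiable_imp_continuous_at g_diff\<close>)
    qed
    show "g holomorphic_on ball 0 1 - {0}"
      using g_diff by (auto simp: holomorphic_on_def intro: field_differentiable_at_within)
  qed auto
  then obtain D where "(g has_field_derivative D) (at 0)"
    using holomorphic_on_imp_differentiable_at[of g "ball 0 1" 0] by (auto simp: field_differentiable_def)
  then have "((\<lambda>q. g q / q) \<longlongrightarrow> D) (at 0)"
    by (simp add: has_field_derivative_iff g_def[of 0])
  then have "((\<lambda>q. cmod (g q / q)) \<longlongrightarrow> cmod D) (at 0)" by (rule tendsto_norm)
  then have "\<forall>\<^sub>F q in at 0. cmod (g q / q) < cmod D + 1"
    by (rule order_tendstoD) simp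
  then obtain d where d: "d > 0" "\<And>q. q \<noteq> 0 \<Longrightarrow> cmod q < d \<Longrightarrow> cmod (g q / q) < cmod D + 1"
    unfolding eventually_at by auto
  define Y where "Y = - N / (2 * pi) * ln (min d 1 / 2)"
  have "cmod (F z) \<le> (cmod D + 1) * exp (- (2 * pi / N) * Im z)" if "Im z \<ge> Y" for z
  proof -
    define w where "w = \<i> * of_real (2 * pi / N) * z"
    have w: "\<kappa> * w = z" using N by (simp add: w_def \<kappa>_def)
    have nw: "cmod (exp w) = exp (- (2 * pi / N) * Im z)" by (simp add: w_def)
    have "- (2 * pi / N) * Im z \<le> ln (min d 1 / 2)"
      using that N by (simp add: Y_def field_simps)
    then have "cmod (exp w) \<le> min d 1 / 2"
      unfolding nw using d(1) by (metis exp_le_cancel_iff exp_ln half_gt_zero min_less_iff_conj zero_less_one)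
    also have "min d 1 / 2 < min d 1" using d(1) by (simp add: min_def)
    finally have small: "cmod (exp w) < d" "cmod (exp w) < 1" by simp_all
    have "cmod (g (exp w) / exp w) < cmod D + 1" by (rule d(2)) (use small in auto)
    then have "cmod (g (exp w)) < (cmod D + 1) * cmod (exp w)"
      by (simp add: norm_divide divide_simps)
    then show ?thesis using F_log[OF small(2)] unfolding w nw by simp
  qed
  then show ?thesis by (rule that)
qed

lemma slash_comp:
  assumes "A \<in> carrier SL2Z" "B \<in> carrier SL2Z" "z \<in> uhp"
  shows "slash k (A ** B) f z = slash k A f (frac_lin B z) / aut_factor B z ^ k"
  using assms by (simp add: slash_def frac_lin_mult aut_factor_mult power_mult_distrib)

lemma slash_holomorphic:
  assumes "f holomorphic_on uhp" "A \<in> carrier SL2Z"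
  shows "slash k A f holomorphic_on uhp"
proof -
  have fl: "frac_lin A holomorphic_on uhp"
    using frac_lin_deriv[OF assms(2)] by (auto simp: holomorphic_on_open open_uhp)
  have "(\<lambda>z. f (frac_lin A z) / aut_factor A z ^ k) holomorphic_on uhp"
  proof (intro holomorphic_intros)
    show "(\<lambda>z. f (frac_lin A z)) holomorphic_on uhp"
      using holomorphic_on_compose_gen[OF fl assms(1)] frac_lin_uhp[OF assms(2)] by (auto simp: o_def)
    show "aut_factor A holomorphic_on uhp"
      unfolding aut_factor_def by (intro holomorphic_intros)
  qed (use aut_factor_nonzero[OF assms(2)] in auto)
  then show ?thesis by (simp add: slash_def[abs_def])
qed

text \<open>A conjugate of the translation by \<open>N\<close> is in the principal congruence subgroup of level \<open>N\<close>,
  so every translate of a form of this level has period \<open>N\<close>.\<close>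

lemma cusp_form_slash_periodic:
  assumes G: "congruence_subgroup G" and f: "cusp_form G k f"
  obtains N :: nat where "N \<ge> 1"
    "\<And>A z. A \<in> carrier SL2Z \<Longrightarrow> z \<in> uhp \<Longrightarrow> slash k A f (z + of_nat N) = slash k A f z"
proof -
  obtain N where N: "N \<ge> 1" "principal_congruence_subgroup N \<subseteq> G"
    using G by (auto simp: congruence_subgroup_def)
  define T where "T = mk_mat 1 (int N) 0 1"
  have T: "T \<in> carrier SL2Z" by (simp add: T_def SL2Z_iff)
  have T_act: "frac_lin T z = z + of_nat N" "aut_factor T z = 1" for z
    by (simp_all add: T_def frac_lin_def aut_factor_def)
  have "slash k A f (z + of_nat N) = slash k A f z" if A: "A \<in> carrier SL2Z" and z: "z \<in> uhp" for A z
  proof -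
    define M where "M = A ** (T ** adj A)"
    have M: "M \<in> carrier SL2Z" unfolding M_def by (intro SL2Z_mult_closed A T adj_SL2Z)
    have det: "A $ 1 $ 1 * A $ 2 $ 2 = 1 + A $ 1 $ 2 * A $ 2 $ 1"
      using A by (simp add: SL2Z_iff)
    have "M $ 1 $ 1 = 1 - int N * (A $ 1 $ 1 * A $ 2 $ 1)" "M $ 1 $ 2 = int N * (A $ 1 $ 1 * A $ 1 $ 1)"
      "M $ 2 $ 1 = - (int N * (A $ 2 $ 1 * A $ 2 $ 1))" "M $ 2 $ 2 = 1 + int N * (A $ 1 $ 1 * A $ 2 $ 1)"
      using det by (simp_all add: M_def T_def adj_def matrix_mult_2 algebra_simps)
    then have "M $ i $ j mod int N = (mat 1 :: int^2^2) $ i $ j mod int N" for i j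
      using exhaust_2[of i] exhaust_2[of j] by (auto simp: mat_2 mod_eq_dvd_iff)
    then have "M \<in> principal_congruence_subgroup N"
      using M by (simp add: principal_congruence_subgroup_def)
    then have "slash k M f u = f u" if "u \<in> uhp" for u
      using f N(2) that by (auto simp: cusp_form_def)
    then have "slash k (M ** A) f z = slash k A f z"
      by (simp add: slash_comp M A z frac_lin_uhp) (simp add: slash_def)
    moreover have "M ** A = A ** T"
      unfolding M_def using adj_SL2Z(2)[OF A] by (simp add: matrix_mul_assoc[symmetric])
    ultimately show ?thesis
      using slash_comp[OF A T z, of k f] by (simp add: T_act)
  qed
  with N(1) show ?thesis by (rule that)
qed

lemma cusp_form_decay:
  assumes G: "congruence_subgroup G" and f: "cusp_form G k f" and A: "A \<in> carrier SL2Z"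
  shows "\<exists>Y. \<forall>z. Im z \<ge> Y \<longrightarrow> cmod (slash k A f z) * Im z ^ M \<le> 1"
proof -
  obtain N :: nat where N: "N \<ge> 1"
    "\<And>A z. A \<in> carrier SL2Z \<Longrightarrow> z \<in> uhp \<Longrightarrow> slash k A f (z + of_nat N) = slash k A f z"
    using cusp_form_slash_periodic[OF G f] by metis
  have "slash k A f holomorphic_on uhp" "(slash k A f \<longlongrightarrow> 0) (filtercomap Im at_top)"
    using f A slash_holomorphic by (auto simp: cusp_form_def)
  then obtain C Y where CY:
    "\<And>z. Im z \<ge> Y \<Longrightarrow> cmod (slash k A f z) \<le> C * exp (- (2 * pi / real N) * Im z)"
    using N(1) N(2)[OF A] by (elim periodic_exp_decay[where N = "real N"]) auto
  define a where "a = 2 * pi / real N"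
  have a: "a > 0" using N(1) by (simp add: a_def)
  have "((\<lambda>y. C * exp (- a * y) * y ^ M) \<longlongrightarrow> 0) at_top"
    using a by real_asymp
  then have "\<forall>\<^sub>F y in at_top. C * exp (- a * y) * y ^ M < 1"
    by (rule order_tendstoD) simp
  then obtain Y' where Y': "\<And>y. y \<ge> Y' \<Longrightarrow> C * exp (- a * y) * y ^ M < 1"
    unfolding eventually_at_top_linorder by auto
  have "cmod (slash k A f z) * Im z ^ M \<le> 1" if "Im z \<ge> max (max Y Y') 0" for z
  proof -
    have "cmod (slash k A f z) * Im z ^ M \<le> (C * exp (- a * Im z)) * Im z ^ M"
      using CY[of z] that by (intro mult_right_mono) (auto simp: a_def)
    with Y'[of "Im z"] that show ?thesis by simp
  qed
  then show ?thesis by blast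
qed

text \<open>This is the only property of the forms used for the convergence of integrals: the pull-back
  by \<open>A\<close> is \<open>O(1 / y\<^sup>2)\<close> on strips, hence integrable towards infinity, and the same bound makes the
  coefficient itself bounded on approach to a finite cusp.\<close>

definition cusp_decay :: "(complex \<Rightarrow> complex) \<Rightarrow> bool" where
  "cusp_decay F \<longleftrightarrow> F holomorphic_on uhp \<and>
     (\<forall>A\<in>carrier SL2Z. \<forall>K. \<exists>C Y. \<forall>z. \<bar>Re z\<bar> \<le> K \<longrightarrow> Im z \<ge> Y \<longrightarrow>
        cmod (F (frac_lin A z) / aut_factor A z ^ 2) \<le> C / (Im z)\<^sup>2)"

text \<open>The pull-back is \<open>(f|A)(z) (a z + b)\<^bsup>m - 1\<^esup> (c z + d)\<^bsup>2r - 1 - m\<^esup> dz\<close>.  The bounds on \<open>m\<close> say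
  that both exponents are nonnegative, so a function of exponential decay is multiplied by one of
  polynomial growth.\<close>

lemma cusp_decay_form:
  assumes G: "congruence_subgroup G" and f: "cusp_form G (2 * r) f"
    and m: "1 \<le> m" "m \<le> 2 * r - 1"
    and F: "\<And>z. z \<in> uhp \<Longrightarrow> F z = f z * z ^ (m - 1)"
  shows "cusp_decay F"
  unfolding cusp_decay_def
proof (intro conjI ballI allI)
  have "(\<lambda>z. f z * z ^ (m - 1)) holomorphic_on uhp"
    using f by (intro holomorphic_intros) (auto simp: cusp_form_def)
  then show "F holomorphic_on uhp"
    by (rule holomorphic_transform) (simp add: F)
  fix A K assume A: "A \<in> carrier SL2Z"
  define e where "e = 2 * r - 1 - m"
  have r: "2 * r = (m - 1) + 2 + e" using m by (simp add: e_def)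
  obtain Y where Y: "\<And>z. Im z \<ge> Y \<Longrightarrow> cmod (slash (2 * r) A f z) * Im z ^ (2 * r) \<le> 1"
    using cusp_form_decay[OF G f A] by blast
  define c where "c = real_of_int (\<bar>A $ 1 $ 1\<bar> + \<bar>A $ 2 $ 1\<bar>) * (\<bar>K\<bar> + 1) + real_of_int (\<bar>A $ 1 $ 2\<bar> + \<bar>A $ 2 $ 2\<bar>)"
  have "cmod (F (frac_lin A z) / aut_factor A z ^ 2) \<le> c ^ (m - 1 + e) / (Im z)\<^sup>2"
    if z: "\<bar>Re z\<bar> \<le> K" "Im z \<ge> max Y 1" for z
  proof -
    have uhp: "z \<in> uhp" and y: "Im z \<ge> 1" "Im z \<ge> Y" using z by (auto simp: uhp_iff)
    define n where "n = of_int (A $ 1 $ 1) * z + of_int (A $ 1 $ 2)"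
    define j where "j = aut_factor A z"
    have j: "j \<noteq> 0" unfolding j_def by (rule aut_factor_nonzero[OF A uhp])
    have zn: "cmod z \<le> (\<bar>K\<bar> + 1) * Im z"
    proof -
      have "cmod z \<le> \<bar>Re z\<bar> + \<bar>Im z\<bar>" by (rule cmod_le)
      also have "\<dots> \<le> \<bar>K\<bar> * Im z + Im z"
        using z(1) y(1) mult_left_mono[of 1 "Im z" "\<bar>K\<bar>"] by linarith
      finally show ?thesis by (simp add: algebra_simps)
    qed
    have lin: "cmod (of_int a * z + of_int b) \<le> (\<bar>of_int a\<bar> * (\<bar>K\<bar> + 1) + \<bar>of_int b\<bar>) * Im z" for a b
    proof -
      have "cmod (of_int a * z + of_int b) \<le> \<bar>of_int a\<bar> * cmod z + \<bar>of_int b\<bar>"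
        by (metis norm_mult norm_of_int norm_triangle_ineq)
      also have "\<dots> \<le> \<bar>of_int a\<bar> * ((\<bar>K\<bar> + 1) * Im z) + \<bar>of_int b\<bar> * Im z"
        using y(1) mult_left_mono[of 1 "Im z" "\<bar>of_int b\<bar>"] by (intro add_mono mult_left_mono zn) auto
      finally show ?thesis by (simp add: algebra_simps)
    qed
    have nb: "cmod n \<le> c * Im z"
    proof (rule order.trans[OF lin[of "A $ 1 $ 1" "A $ 1 $ 2", folded n_def]], rule mult_right_mono)
      show "\<bar>real_of_int (A $ 1 $ 1)\<bar> * (\<bar>K\<bar> + 1) + \<bar>real_of_int (A $ 1 $ 2)\<bar> \<le> c"
        by (simp add: c_def algebra_simps)
    qed (use y in simp)
    have jb: "cmod j \<le> c * Im z"
    proof (rule order.trans[OF lin[of "A $ 2 $ 1" "A $ 2 $ 2", folded aut_factor_def, folded j_def]], rule mult_right_mono)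
      show "\<bar>real_of_int (A $ 2 $ 1)\<bar> * (\<bar>K\<bar> + 1) + \<bar>real_of_int (A $ 2 $ 2)\<bar> \<le> c"
        by (simp add: c_def algebra_simps)
    qed (use y in simp)
    have "F (frac_lin A z) = f (frac_lin A z) * (n / j) ^ (m - 1)"
      by (simp add: F frac_lin_uhp A uhp) (simp add: frac_lin_def n_def j_def)
    then have eq: "F (frac_lin A z) / j ^ 2 = slash (2 * r) A f z * (n ^ (m - 1) * j ^ e)"
      using j by (simp add: slash_def r j_def[symmetric] power_add power_divide power2_eq_square)
    have "cmod (n ^ (m - 1) * j ^ e) \<le> (c * Im z) ^ (m - 1) * (c * Im z) ^ e"
      unfolding norm_mult norm_power by (intro mult_mono power_mono nb jb) (auto intro!: zero_le_power order.trans[OF norm_ge_zero nb])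
    also have "\<dots> = c ^ (m - 1 + e) * Im z ^ (m - 1 + e)"
      by (simp add: power_add power_mult_distrib)
    finally have "cmod (F (frac_lin A z) / j ^ 2) \<le>
        cmod (slash (2 * r) A f z) * (c ^ (m - 1 + e) * Im z ^ (m - 1 + e))"
      unfolding eq norm_mult by (intro mult_left_mono) auto
    also have "\<dots> = c ^ (m - 1 + e) / (Im z)\<^sup>2 * (cmod (slash (2 * r) A f z) * Im z ^ (2 * r))"
      using y by (simp add: r power_add power2_eq_square)
    also have "\<dots> \<le> c ^ (m - 1 + e) / (Im z)\<^sup>2 * 1"
    proof (rule mult_left_mono[OF Y[OF y(2)]])
      have "0 \<le> c" by (simp add: c_def)
      then show "0 \<le> c ^ (m - 1 + e) / (Im z)\<^sup>2" by simp
    qed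
    finally show ?thesis by (simp add: j_def)
  qed
  then show "\<exists>C Y. \<forall>z. \<bar>Re z\<bar> \<le> K \<longrightarrow> Im z \<ge> Y \<longrightarrow>
      cmod (F (frac_lin A z) / aut_factor A z ^ 2) \<le> C / (Im z)\<^sup>2" by blast
qed

section \<open>Iterated primitives normalized at a cusp\<close>

text \<open>Along the imaginary axis \<open>q\<close> is Cauchy by comparison with \<open>1 / y\<close>, and within a strip it
  varies horizontally by \<open>O(1 / y\<^sup>2)\<close>.\<close>

lemma strip_limit:
  fixes q :: "complex \<Rightarrow> complex"
  assumes der: "\<And>z. z \<in> uhp \<Longrightarrow> (q has_field_derivative q' z) (at z)"
    and bound: "\<And>K. \<exists>C Y. \<forall>z. \<bar>Re z\<bar> \<le> K \<longrightarrow> Im z \<ge> Y \<longrightarrow> cmod (q' z) \<le> C / (Im z)\<^sup>2"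
  shows "\<exists>l. (q \<longlongrightarrow> l) cusp_strip"
proof -
  obtain C0 Y0 where C0: "\<And>z. \<bar>Re z\<bar> \<le> 0 \<Longrightarrow> Im z \<ge> Y0 \<Longrightarrow> cmod (q' z) \<le> C0 / (Im z)\<^sup>2"
    using bound by blast
  define C where "C = \<bar>C0\<bar>"
  define Y where "Y = max Y0 1"
  have vert: "cmod (q (Complex 0 y2) - q (Complex 0 y1)) \<le> C / y1" if y: "Y \<le> y1" "y1 \<le> y2" for y1 y2
  proof (cases "y1 = y2")
    case True
    then show ?thesis using y by (simp add: C_def Y_def)
  next
    case False
    have pos: "y1 > 0" using y by (simp add: Y_def)
    have dq: "((\<lambda>y. q (Complex 0 y)) has_vector_derivative \<i> * q' (Complex 0 x)) (at x)" if "x \<ge> y1" for x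
    proof (rule field_vector_diff_chain_at[of "Complex 0" \<i> x q, unfolded o_def])
      have eq: "(\<lambda>x. of_real x * \<i>) = Complex 0" by (simp add: fun_eq_iff complex_eq_iff)
      have "((\<lambda>x. of_real x * \<i>) has_vector_derivative \<i>) (at x)"
        by (auto intro!: derivative_eq_intros)
      then show "(Complex 0 has_vector_derivative \<i>) (at x)"
        unfolding eq .
      show "(q has_field_derivative q' (Complex 0 x)) (at (Complex 0 x))"
        by (rule der) (use that pos in \<open>simp add: uhp_iff\<close>)
    qed
    have "norm (q (Complex 0 y2) - q (Complex 0 y1)) \<le> (- C / y2) - (- C / y1)"
    proof (rule differentiable_bound_general[where f = "\<lambda>y. q (Complex 0 y)" and \<phi> = "\<lambda>y. - C / y"])
      show "y1 < y2" using y False by simp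
      show "continuous_on {y1..y2} (\<lambda>y. q (Complex 0 y))"
        using dq by (intro continuous_at_imp_continuous_on ballI has_vector_derivative_continuous) auto
      show "continuous_on {y1..y2} (\<lambda>y. - C / y)"
        using pos by (intro continuous_intros) auto
      fix x assume x: "y1 < x" "x < y2"
      show "((\<lambda>y. q (Complex 0 y)) has_vector_derivative \<i> * q' (Complex 0 x)) (at x)"
        using x by (intro dq) simp
      have "((\<lambda>y. - C / y) has_real_derivative C / x\<^sup>2) (at x)"
        using x pos by (auto intro!: derivative_eq_intros simp: power2_eq_square field_simps)
      then show "((\<lambda>y. - C / y) has_vector_derivative C / x\<^sup>2) (at x)"
        by (simp add: has_real_derivative_iff_has_vector_derivative)
      have "cmod (q' (Complex 0 x)) \<le> C0 / x\<^sup>2"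
        using C0[of "Complex 0 x"] x y by (simp add: Y_def)
      also have "\<dots> \<le> C / x\<^sup>2" by (simp add: C_def divide_right_mono)
      finally show "norm (\<i> * q' (Complex 0 x)) \<le> C / x\<^sup>2" by (simp add: norm_mult)
    qed
    also have "\<dots> \<le> C / y1" using pos y by (simp add: C_def)
    finally show ?thesis .
  qed
  have C_nonneg: "C \<ge> 0" by (simp add: C_def)
  have "Cauchy (\<lambda>n. q (Complex 0 (real n)))"
  proof (rule CauchyI')
    fix e :: real assume e: "e > 0"
    obtain M :: nat where M: "real M > max Y (C / e)" using reals_Archimedean2 by blast
    show "\<exists>M. \<forall>m\<ge>M. \<forall>n>m. dist (q (Complex 0 (real m))) (q (Complex 0 (real n))) < e"
    proof (intro exI[of _ M] allI impI)
      fix m n assume mn: "m \<ge> M" "m < n"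
      then have m: "real m \<ge> Y" "real m > C / e" "real m > 0" using M by (auto simp: Y_def)
      have "cmod (q (Complex 0 (real n)) - q (Complex 0 (real m))) \<le> C / real m"
        using mn m by (intro vert) auto
      also have "\<dots> < e" using m e by (simp add: field_simps)
      finally show "dist (q (Complex 0 (real m))) (q (Complex 0 (real n))) < e"
        by (simp add: dist_norm norm_minus_commute)
    qed
  qed
  then obtain l where l: "(\<lambda>n. q (Complex 0 (real n))) \<longlonglongrightarrow> l"
    using Cauchy_convergent_iff convergent_def by blast
  have axis: "cmod (l - q (Complex 0 y)) \<le> C / y" if "y \<ge> Y" for y
  proof (rule tendsto_upperbound)
    show "(\<lambda>n. cmod (q (Complex 0 (real n)) - q (Complex 0 y))) \<longlonglongrightarrow> cmod (l - q (Complex 0 y))"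
      by (intro tendsto_intros l)
    obtain N :: nat where "real N \<ge> y" using real_arch_simple by blast
    then have "y \<le> real n" if "n \<ge> N" for n using that by linarith
    then show "\<forall>\<^sub>F n in sequentially. cmod (q (Complex 0 (real n)) - q (Complex 0 y)) \<le> C / y"
      using that by (auto simp: eventually_sequentially intro!: vert exI[of _ N])
  qed simp
  have "(q \<longlongrightarrow> l) cusp_strip"
  proof (rule tendstoI, rule eventually_cusp_stripI)
    fix e K :: real assume e: "e > 0" and K: "K \<ge> 0"
    obtain CK YK where CK: "\<And>z. \<bar>Re z\<bar> \<le> K \<Longrightarrow> Im z \<ge> YK \<Longrightarrow> cmod (q' z) \<le> CK / (Im z)\<^sup>2"
      using bound by blast
    define D where "D = \<bar>CK\<bar> * K + C"
    define Y1 where "Y1 = max (max Y YK) (D / e + 1)"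
    have "dist (q z) l < e" if z: "\<bar>Re z\<bar> \<le> K" "Im z \<ge> Y1" for z
    proof -
      define y where "y = Im z"
      have y: "y \<ge> Y" "y \<ge> YK" "y \<ge> 1" "y > D / e" using z by (auto simp: y_def Y1_def Y_def)
      define S where "S = cbox (Complex (- K) y) (Complex K y)"
      have S: "u \<in> S \<longleftrightarrow> \<bar>Re u\<bar> \<le> K \<and> Im u = y" for u
        by (auto simp: S_def in_cbox_complex_iff)
      have "norm (q z - q (Complex 0 y)) \<le> (CK / y\<^sup>2) * norm (z - Complex 0 y)"
      proof (rule field_differentiable_bound[where S = S])
        show "convex S" by (simp add: S_def)
        show "(q has_field_derivative q' u) (at u within S)" if "u \<in> S" for u
          using that y by (intro has_field_derivative_at_within[OF der]) (auto simp: S uhp_iff)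
        show "norm (q' u) \<le> CK / y\<^sup>2" if "u \<in> S" for u
          using CK[of u] that y by (auto simp: S)
      qed (use z K in \<open>auto simp: S y_def\<close>)
      also have "norm (z - Complex 0 y) = \<bar>Re z\<bar>" by (simp add: y_def cmod_def)
      also have "(CK / y\<^sup>2) * \<bar>Re z\<bar> \<le> (\<bar>CK\<bar> / y) * K"
      proof (rule mult_mono[OF _ z(1)])
        have "CK / y\<^sup>2 \<le> \<bar>CK\<bar> / y\<^sup>2" by (rule divide_right_mono) auto
        also have "\<dots> \<le> \<bar>CK\<bar> / y"
          using y(3) by (intro divide_left_mono) (auto simp: power2_eq_square)
        finally show "CK / y\<^sup>2 \<le> \<bar>CK\<bar> / y" .
      qed (use y in auto)
      finally have "cmod (q z - l) \<le> (\<bar>CK\<bar> / y) * K + C / y"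
        using axis[OF y(1)] norm_triangle_ineq[of "q z - q (Complex 0 y)" "q (Complex 0 y) - l"]
        by (simp add: norm_minus_commute)
      also have "\<dots> = D / y" by (simp add: D_def add_divide_distrib)
      also have "\<dots> < e" using y e by (simp add: field_simps)
      finally show ?thesis by (simp add: dist_norm)
    qed
    then show "\<exists>Y. \<forall>z. \<bar>Re z\<bar> \<le> K \<longrightarrow> Im z \<ge> Y \<longrightarrow> dist (q z) l < e" by blast
  qed
  then show ?thesis ..
qed

lemma cusp_primitive:
  assumes F: "cusp_decay F" and u: "u holomorphic_on uhp"
    and lim: "\<And>a. \<exists>l. (u \<longlongrightarrow> l) (cusp_nhds a)"
  shows "\<exists>P. (\<forall>z\<in>uhp. (P has_field_derivative F z * u z) (at z)) \<and> (P \<longlongrightarrow> 0) (cusp_nhds b) \<and>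
    (\<forall>a. \<exists>l. (P \<longlongrightarrow> l) (cusp_nhds a))"
proof -
  have hol: "(\<lambda>z. F z * u z) holomorphic_on uhp"
    using F u by (auto simp: cusp_decay_def intro!: holomorphic_intros)
  obtain P where "\<And>z. z \<in> uhp \<Longrightarrow> (P has_field_derivative F z * u z) (at z within uhp)"
    using holomorphic_convex_primitive'[OF convex_uhp open_uhp hol] by metis
  then have P: "(P has_field_derivative F z * u z) (at z)" if "z \<in> uhp" for z
    using that open_uhp by (metis at_within_open)
  have P_lim: "\<exists>l. (P \<longlongrightarrow> l) (cusp_nhds a)" for a
  proof -
    obtain A where A: "A \<in> carrier SL2Z" "cusp_act A Cusp_Infinity = a" by (rule cusp_transitive)
    have nhds: "cusp_nhds a = filtermap (frac_lin A) cusp_strip" using cusp_nhds_eq[OF A(1)] A(2) by simp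
    obtain l where "(u \<longlongrightarrow> l) (cusp_nhds a)" using lim by blast
    then have "((\<lambda>z. cmod (u (frac_lin A z))) \<longlongrightarrow> cmod l) cusp_strip"
      unfolding nhds by (intro tendsto_norm) (simp add: filterlim_filtermap)
    then have bnd: "\<forall>\<^sub>F z in cusp_strip. cmod (u (frac_lin A z)) < cmod l + 1"
      by (rule order_tendstoD) simp
    have "\<exists>l. ((\<lambda>z. P (frac_lin A z)) \<longlongrightarrow> l) cusp_strip"
    proof (rule strip_limit)
      fix z assume "z \<in> uhp"
      then show "((\<lambda>z. P (frac_lin A z)) has_field_derivative
          F (frac_lin A z) * u (frac_lin A z) * (1 / aut_factor A z ^ 2)) (at z)"
        by (intro DERIV_chain2[OF P frac_lin_deriv] frac_lin_uhp A)
    next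
      fix K
      obtain C Y where C: "\<And>z. \<bar>Re z\<bar> \<le> K \<Longrightarrow> Im z \<ge> Y \<Longrightarrow>
          cmod (F (frac_lin A z) / aut_factor A z ^ 2) \<le> C / (Im z)\<^sup>2"
        using F A(1) unfolding cusp_decay_def by meson
      obtain Y' where Y': "\<And>z. \<bar>Re z\<bar> \<le> K \<Longrightarrow> Im z \<ge> Y' \<Longrightarrow> cmod (u (frac_lin A z)) < cmod l + 1"
        using bnd unfolding eventually_cusp_strip by meson
      have "cmod (F (frac_lin A z) * u (frac_lin A z) * (1 / aut_factor A z ^ 2))
          \<le> (C * (cmod l + 1)) / (Im z)\<^sup>2" if "\<bar>Re z\<bar> \<le> K" "Im z \<ge> max Y Y'" for z
      proof -
        have c: "cmod (F (frac_lin A z) / aut_factor A z ^ 2) \<le> C / (Im z)\<^sup>2"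
          using that by (intro C) auto
        have "cmod (F (frac_lin A z) * u (frac_lin A z) * (1 / aut_factor A z ^ 2)) =
            cmod (F (frac_lin A z) / aut_factor A z ^ 2) * cmod (u (frac_lin A z))"
          by (simp add: norm_mult norm_divide)
        also have "\<dots> \<le> (C / (Im z)\<^sup>2) * (cmod l + 1)"
          using Y'[of z] that c by (intro mult_mono order.trans[OF norm_ge_zero c]) auto
        finally show ?thesis by simp
      qed
      then show "\<exists>C Y. \<forall>z. \<bar>Re z\<bar> \<le> K \<longrightarrow> Im z \<ge> Y \<longrightarrow>
          cmod (F (frac_lin A z) * u (frac_lin A z) * (1 / aut_factor A z ^ 2)) \<le> C / (Im z)\<^sup>2"
        by blast
    qed
    then show ?thesis unfolding nhds by (simp add: filterlim_filtermap)
  qed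
  obtain l where l: "(P \<longlongrightarrow> l) (cusp_nhds b)" using P_lim by blast
  show ?thesis
  proof (intro exI[of _ "\<lambda>z. P z - l"] conjI ballI allI)
    show "((\<lambda>z. P z - l) has_field_derivative F z * u z) (at z)" if "z \<in> uhp" for z
      using P[OF that] by (auto intro!: derivative_eq_intros)
    show "((\<lambda>z. P z - l) \<longlongrightarrow> 0) (cusp_nhds b)" using tendsto_diff[OF l tendsto_const[of l]] by simp
    show "\<exists>l'. ((\<lambda>z. P z - l) \<longlongrightarrow> l') (cusp_nhds a)" for a
      using P_lim[of a] by (blast intro: tendsto_diff[OF _ tendsto_const])
  qed
qed

text \<open>These are the coefficients of \<open>z \<mapsto> J\<^sub>b\<^sup>z\<close>.  The choice determines the values on the upper
  half plane by \<open>uhp_unique\<close>; the conditions can be met by \<open>cusp_primitive\<close>.\<close>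

primrec iter_prim :: "('v \<Rightarrow> complex \<Rightarrow> complex) \<Rightarrow> cusp \<Rightarrow> 'v list \<Rightarrow> complex \<Rightarrow> complex" where
  "iter_prim \<omega> b [] = (\<lambda>z. 1)"
| "iter_prim \<omega> b (v # w) = (SOME P. (\<forall>z\<in>uhp. (P has_field_derivative \<omega> v z * iter_prim \<omega> b w z) (at z)) \<and>
     (P \<longlongrightarrow> 0) (cusp_nhds b) \<and> (\<forall>a. \<exists>l. (P \<longlongrightarrow> l) (cusp_nhds a)))"

text \<open>This is \<open>J\<^sub>b\<^sup>a\<close>, obtained from \<open>J\<^sub>b\<^sup>z\<close> in the limit \<open>z \<rightarrow> a\<close>.\<close>

definition iter_lim :: "'v set \<Rightarrow> ('v \<Rightarrow> complex \<Rightarrow> complex) \<Rightarrow> cusp \<Rightarrow> cusp \<Rightarrow> 'v nc_series" where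
  "iter_lim V \<omega> b a = (\<lambda>w. if w \<in> lists V then Lim (cusp_nhds a) (iter_prim \<omega> b w) else 0)"

lemma iter_lim_Nil: "iter_lim V \<omega> b a [] = 1"
  by (simp add: iter_lim_def tendsto_Lim[OF cusp_nhds_neq_bot tendsto_const])

lemma nc_mult_deriv:
  fixes S :: "complex \<Rightarrow> 'v nc_series"
  assumes "\<And>i. i \<le> length w \<Longrightarrow> ((\<lambda>z. S z (take i w)) has_field_derivative S' (take i w)) (at z)"
  shows "((\<lambda>z. nc_mult (S z) T w) has_field_derivative nc_mult S' T w) (at z)"
  unfolding nc_mult_def by (intro DERIV_sum DERIV_cmult_right assms) simp

lemma nc_subst_deriv:
  fixes S :: "complex \<Rightarrow> 'v nc_series"
  assumes "\<And>x. x \<in> lists V \<Longrightarrow> length x = length w \<Longrightarrow> ((\<lambda>z. S z x) has_field_derivative S' x) (at z)"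
  shows "((\<lambda>z. nc_subst V g (S z) w) has_field_derivative nc_subst V g S' w) (at z)"
  using assms
proof (induction w arbitrary: S S')
  case (Cons v w)
  have "((\<lambda>z. nc_subst V g (\<lambda>x. S z (u # x)) w) has_field_derivative nc_subst V g (\<lambda>x. S' (u # x)) w) (at z)"
    if "u \<in> V" for u using that by (intro Cons.IH Cons.prems) auto
  then show ?case by (auto intro!: DERIV_sum DERIV_cmult)
qed auto

lemma nc_subst_tendsto:
  fixes S :: "complex \<Rightarrow> 'v nc_series"
  assumes "\<And>x. x \<in> lists V \<Longrightarrow> length x = length w \<Longrightarrow> ((\<lambda>z. S z x) \<longlongrightarrow> S' x) F"
  shows "((\<lambda>z. nc_subst V g (S z) w) \<longlongrightarrow> nc_subst V g S' w) F"
  using assms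
proof (induction w arbitrary: S S')
  case (Cons v w)
  have "((\<lambda>z. nc_subst V g (\<lambda>x. S z (u # x)) w) \<longlongrightarrow> nc_subst V g (\<lambda>x. S' (u # x)) w) F"
    if "u \<in> V" for u using that by (intro Cons.IH Cons.prems) auto
  then show ?case by (auto intro!: tendsto_intros)
qed auto

lemma uhp_unique:
  assumes "\<And>z. z \<in> uhp \<Longrightarrow> (P has_field_derivative h z) (at z)"
    and "\<And>z. z \<in> uhp \<Longrightarrow> (Q has_field_derivative h z) (at z)"
    and "(P \<longlongrightarrow> l) (cusp_nhds b)" "(Q \<longlongrightarrow> l) (cusp_nhds b)" and z: "z \<in> uhp"
  shows "P z = Q z"
proof -
  have "((\<lambda>z. P z - Q z) has_field_derivative 0) (at z within uhp)" if "z \<in> uhp" for z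
    using DERIV_diff[OF assms(1,2)[OF that]] by (simp add: has_field_derivative_at_within)
  then obtain c where c: "\<And>z. z \<in> uhp \<Longrightarrow> P z - Q z = c"
    using has_field_derivative_zero_constant[OF convex_uhp, of "\<lambda>z. P z - Q z"] by blast
  have "((\<lambda>z. P z - Q z) \<longlongrightarrow> l - l) (cusp_nhds b)" by (intro tendsto_diff assms)
  moreover have "((\<lambda>z. P z - Q z) \<longlongrightarrow> c) (cusp_nhds b)"
    using eventually_cusp_nhds_uhp[of b] by (intro tendsto_eventually) (auto elim!: eventually_mono simp: c)
  ultimately have "c = 0" using tendsto_unique[OF cusp_nhds_neq_bot] by fastforce
  then show ?thesis using c[OF z] by simp
qed

context
  fixes V :: "'v set" and \<omega> :: "'v \<Rightarrow> complex \<Rightarrow> complex"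
  assumes decay: "\<And>v. v \<in> V \<Longrightarrow> cusp_decay (\<omega> v)"
begin

lemma iter_prim_aux:
  assumes "w \<in> lists V"
  shows "iter_prim \<omega> b w holomorphic_on uhp \<and> (\<forall>a. \<exists>l. (iter_prim \<omega> b w \<longlongrightarrow> l) (cusp_nhds a)) \<and>
    (\<forall>v\<in>V. (\<forall>z\<in>uhp. (iter_prim \<omega> b (v # w) has_field_derivative \<omega> v z * iter_prim \<omega> b w z) (at z)) \<and>
     (iter_prim \<omega> b (v # w) \<longlongrightarrow> 0) (cusp_nhds b) \<and> (\<forall>a. \<exists>l. (iter_prim \<omega> b (v # w) \<longlongrightarrow> l) (cusp_nhds a)))"
proof -
  let ?P = "\<lambda>v w. (\<forall>z\<in>uhp. (iter_prim \<omega> b (v # w) has_field_derivative \<omega> v z * iter_prim \<omega> b w z) (at z)) \<and>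
     (iter_prim \<omega> b (v # w) \<longlongrightarrow> 0) (cusp_nhds b) \<and> (\<forall>a. \<exists>l. (iter_prim \<omega> b (v # w) \<longlongrightarrow> l) (cusp_nhds a))"
  have step: "?P v w" if "iter_prim \<omega> b w holomorphic_on uhp"
    "\<And>a. \<exists>l. (iter_prim \<omega> b w \<longlongrightarrow> l) (cusp_nhds a)" "v \<in> V" for v w
    unfolding iter_prim.simps(2) by (rule someI_ex[OF cusp_primitive[OF decay[OF that(3)] that(1,2)]])
  show ?thesis using assms
  proof (induction w rule: list.induct)
    case Nil
    have 1: "iter_prim \<omega> b [] holomorphic_on uhp" by simp
    have 2: "\<exists>l. (iter_prim \<omega> b [] \<longlongrightarrow> l) (cusp_nhds a)" for a by (auto intro: tendsto_const)
    show ?case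
      using 1 2 step[OF 1 2] by blast
  next
    case (Cons v w)
    then have v: "v \<in> V" and IH: "\<forall>z\<in>uhp. (iter_prim \<omega> b (v # w) has_field_derivative \<omega> v z * iter_prim \<omega> b w z) (at z)"
      "\<And>a. \<exists>l. (iter_prim \<omega> b (v # w) \<longlongrightarrow> l) (cusp_nhds a)" by auto
    have 1: "iter_prim \<omega> b (v # w) holomorphic_on uhp"
      using IH(1) by (auto simp: holomorphic_on_open open_uhp simp del: iter_prim.simps)
    show ?case
      using 1 IH(2) step[OF 1 IH(2)] by blast
  qed
qed

lemma iter_prim_deriv:
  "v # w \<in> lists V \<Longrightarrow> z \<in> uhp \<Longrightarrow>
    (iter_prim \<omega> b (v # w) has_field_derivative \<omega> v z * iter_prim \<omega> b w z) (at z)"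
  using iter_prim_aux[of w b] by (auto simp del: iter_prim.simps)

lemma iter_prim_start:
  "w \<in> lists V \<Longrightarrow> (iter_prim \<omega> b w \<longlongrightarrow> nc_one w) (cusp_nhds b)"
  using iter_prim_aux[of "tl w" b] by (cases w) (auto simp: nc_one_def simp del: iter_prim.simps(2))

lemma iter_prim_lim:
  assumes "w \<in> lists V"
  shows "(iter_prim \<omega> b w \<longlongrightarrow> iter_lim V \<omega> b a w) (cusp_nhds a)"
proof -
  obtain l where l: "(iter_prim \<omega> b w \<longlongrightarrow> l) (cusp_nhds a)"
    using iter_prim_aux[OF assms] by blast
  with tendsto_Lim[OF cusp_nhds_neq_bot l] assms show ?thesis by (simp add: iter_lim_def)
qed

lemma iter_lim_eqI:
  "w \<in> lists V \<Longrightarrow> (iter_prim \<omega> b w \<longlongrightarrow> l) (cusp_nhds a) \<Longrightarrow> iter_lim V \<omega> b a w = l"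
  using tendsto_unique[OF cusp_nhds_neq_bot iter_prim_lim] by blast

lemma iter_lim_Pi: "iter_lim V \<omega> b a \<in> carrier (nc_Pi V)"
  by (simp add: nc_Pi_simps nc_ring_simps iter_lim_Nil) (simp add: iter_lim_def)

lemma iter_lim_same: "iter_lim V \<omega> b b = nc_one"
proof
  fix w show "iter_lim V \<omega> b b w = nc_one w"
    using iter_lim_eqI[OF _ iter_prim_start, of w] by (cases "w \<in> lists V") (auto simp: iter_lim_def nc_one_def)
qed

text \<open>Two solutions of \<open>d J = (\<Sum>\<^sub>v A\<^sub>v \<omega>\<^sub>v) J\<close> differ by a constant factor on the right, which is
  found by comparing limits at \<open>b\<close>.\<close>

lemma iter_prim_change_base:
  assumes "w \<in> lists V" "z \<in> uhp"
  shows "iter_prim \<omega> c w z = nc_mult (\<lambda>x. iter_prim \<omega> b x z) (iter_lim V \<omega> c b) w"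
  using assms
proof (induction w arbitrary: z rule: list.induct)
  case Nil
  show ?case by (simp add: iter_lim_Nil)
next
  case (Cons v w)
  let ?J = "iter_lim V \<omega> c b"
  have vw: "v \<in> V" "w \<in> lists V" "v # w \<in> lists V" using Cons.prems by auto
  have sub: "take i w \<in> lists V" for i using vw(2) by (auto dest: in_set_takeD)
  show ?case
  proof (rule uhp_unique[OF _ _ _ _ Cons.prems(2)])
    fix z assume z: "z \<in> uhp"
    show "(iter_prim \<omega> c (v # w) has_field_derivative \<omega> v z * iter_prim \<omega> c w z) (at z)"
      by (rule iter_prim_deriv[OF vw(3) z])
    have "((\<lambda>z. nc_mult (\<lambda>x. iter_prim \<omega> b (v # x) z) ?J w) has_field_derivative
        nc_mult (\<lambda>x. \<omega> v z * iter_prim \<omega> b x z) ?J w) (at z)"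
      using vw sub z by (intro nc_mult_deriv iter_prim_deriv) auto
    then show "((\<lambda>z. nc_mult (\<lambda>x. iter_prim \<omega> b x z) ?J (v # w)) has_field_derivative
        \<omega> v z * iter_prim \<omega> c w z) (at z)"
      unfolding nc_mult_Cons nc_mult_smult_left Cons.IH[OF vw(2) z]
      by (auto intro!: derivative_eq_intros)
  next
    show "(iter_prim \<omega> c (v # w) \<longlongrightarrow> ?J (v # w)) (cusp_nhds b)"
      by (rule iter_prim_lim[OF vw(3)])
    have "((\<lambda>z. nc_mult (\<lambda>x. iter_prim \<omega> b (v # x) z) ?J w) \<longlongrightarrow>
        (\<Sum>i\<le>length w. nc_one (v # take i w) * ?J (drop i w))) (cusp_nhds b)"
      unfolding nc_mult_def using vw sub by (intro tendsto_intros iter_prim_start) auto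
    then have "((\<lambda>z. nc_mult (\<lambda>x. iter_prim \<omega> b (v # x) z) ?J w) \<longlongrightarrow> 0) (cusp_nhds b)"
      by (simp add: nc_one_def)
    then show "((\<lambda>z. nc_mult (\<lambda>x. iter_prim \<omega> b x z) ?J (v # w)) \<longlongrightarrow> ?J (v # w)) (cusp_nhds b)"
      unfolding nc_mult_Cons by (auto intro!: tendsto_eq_intros)
  qed
qed

lemma iter_lim_compose: "iter_lim V \<omega> c a = nc_mult (iter_lim V \<omega> b a) (iter_lim V \<omega> c b)"
proof
  fix w show "iter_lim V \<omega> c a w = nc_mult (iter_lim V \<omega> b a) (iter_lim V \<omega> c b) w"
  proof (cases "w \<in> lists V")
    case True
    then have sub: "take i w \<in> lists V" for i by (auto dest: in_set_takeD)
    have "((\<lambda>z. nc_mult (\<lambda>x. iter_prim \<omega> b x z) (iter_lim V \<omega> c b) w) \<longlongrightarrow>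
        nc_mult (iter_lim V \<omega> b a) (iter_lim V \<omega> c b) w) (cusp_nhds a)"
      unfolding nc_mult_def by (intro tendsto_intros iter_prim_lim sub)
    moreover have "\<forall>\<^sub>F z in cusp_nhds a. nc_mult (\<lambda>x. iter_prim \<omega> b x z) (iter_lim V \<omega> c b) w =
        iter_prim \<omega> c w z"
      using eventually_cusp_nhds_uhp by eventually_elim (simp add: iter_prim_change_base[OF True, of _ c b])
    ultimately have "(iter_prim \<omega> c w \<longlongrightarrow> nc_mult (iter_lim V \<omega> b a) (iter_lim V \<omega> c b) w) (cusp_nhds a)"
      by (rule Lim_transform_eventually)
    then show ?thesis by (rule iter_lim_eqI[OF True])
  next
    case False
    have "nc_mult (iter_lim V \<omega> b a) (iter_lim V \<omega> c b) \<in> carrier (nc_ring V)"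
      using iter_lim_Pi by (intro nc_mult_carrier) (auto simp: nc_Pi_simps)
    with False show ?thesis by (simp add: nc_ring_simps iter_lim_def)
  qed
qed

text \<open>Both sides satisfy the differential equation pulled back by \<open>\<gamma>\<close>, in which each \<open>\<omega>\<^sub>v\<close> is
  replaced by \<open>\<Sum>\<^sub>u g\<^sub>v\<^sub>u \<omega>\<^sub>u\<close>, and both tend to \<open>1\<close> at \<open>b\<close>.\<close>

lemma iter_prim_equivariant:
  assumes \<gamma>: "\<gamma> \<in> carrier SL2Z"
    and g: "\<And>v z. v \<in> V \<Longrightarrow> z \<in> uhp \<Longrightarrow> pullback_form (frac_lin \<gamma>) (\<omega> v) z = (\<Sum>u\<in>V. g v u * \<omega> u z)"
    and w: "w \<in> lists V" and z: "z \<in> uhp"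
  shows "iter_prim \<omega> (cusp_act \<gamma> b) w (frac_lin \<gamma> z) = nc_subst V g (\<lambda>x. iter_prim \<omega> b x z) w"
  using w z
proof (induction w arbitrary: z rule: list.induct)
  case (Cons v w)
  have vw: "v \<in> V" "w \<in> lists V" "v # w \<in> lists V" using Cons.prems by auto
  show ?case
  proof (rule uhp_unique[OF _ _ _ _ Cons.prems(2)])
    fix z assume z: "z \<in> uhp"
    let ?h = "(\<Sum>u\<in>V. g v u * \<omega> u z) * nc_subst V g (\<lambda>x. iter_prim \<omega> b x z) w"
    have "((\<lambda>z. iter_prim \<omega> (cusp_act \<gamma> b) (v # w) (frac_lin \<gamma> z)) has_field_derivative
        \<omega> v (frac_lin \<gamma> z) * iter_prim \<omega> (cusp_act \<gamma> b) w (frac_lin \<gamma> z) * (1 / aut_factor \<gamma> z ^ 2)) (at z)"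
      by (rule DERIV_chain2[OF iter_prim_deriv[OF vw(3)]]) (auto intro: frac_lin_uhp frac_lin_deriv \<gamma> z)
    also have "\<omega> v (frac_lin \<gamma> z) * iter_prim \<omega> (cusp_act \<gamma> b) w (frac_lin \<gamma> z) * (1 / aut_factor \<gamma> z ^ 2) = ?h"
      unfolding Cons.IH[OF vw(2) z] g[OF vw(1) z, symmetric]
      by (simp add: pullback_form_def deriv_frac_lin[OF \<gamma> z])
    finally show "((\<lambda>z. iter_prim \<omega> (cusp_act \<gamma> b) (v # w) (frac_lin \<gamma> z)) has_field_derivative ?h) (at z)" .
    have "((\<lambda>z. nc_subst V g (\<lambda>x. iter_prim \<omega> b (u # x) z) w) has_field_derivative
        nc_subst V g (\<lambda>x. \<omega> u z * iter_prim \<omega> b x z) w) (at z)" if "u \<in> V" for u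
      using that z by (intro nc_subst_deriv iter_prim_deriv) auto
    then have "((\<lambda>z. nc_subst V g (\<lambda>x. iter_prim \<omega> b x z) (v # w)) has_field_derivative
        (\<Sum>u\<in>V. g v u * nc_subst V g (\<lambda>x. \<omega> u z * iter_prim \<omega> b x z) w)) (at z)"
      using vw(1) by (auto intro!: DERIV_sum DERIV_cmult simp del: iter_prim.simps)
    then show "((\<lambda>z. nc_subst V g (\<lambda>x. iter_prim \<omega> b x z) (v # w)) has_field_derivative ?h) (at z)"
      by (simp add: nc_subst_smult sum_distrib_right mult.assoc)
  next
    have "(iter_prim \<omega> (cusp_act \<gamma> b) (v # w) \<longlongrightarrow> 0) (filtermap (frac_lin \<gamma>) (cusp_nhds b))"
      unfolding cusp_nhds_act[OF \<gamma>, symmetric]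
      using iter_prim_start[OF vw(3), of "cusp_act \<gamma> b"] by (simp add: nc_one_def del: iter_prim.simps)
    then show "((\<lambda>z. iter_prim \<omega> (cusp_act \<gamma> b) (v # w) (frac_lin \<gamma> z)) \<longlongrightarrow> 0) (cusp_nhds b)"
      by (simp add: filterlim_filtermap del: iter_prim.simps)
    have "((\<lambda>z. nc_subst V g (\<lambda>x. iter_prim \<omega> b x z) (v # w)) \<longlongrightarrow> nc_subst V g nc_one (v # w)) (cusp_nhds b)"
      by (rule nc_subst_tendsto) (rule iter_prim_start)
    then show "((\<lambda>z. nc_subst V g (\<lambda>x. iter_prim \<omega> b x z) (v # w)) \<longlongrightarrow> 0) (cusp_nhds b)"
      unfolding nc_subst_one by (simp add: nc_one_def del: iter_prim.simps)
  qed
qed simp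

lemma iter_lim_equivariant:
  assumes \<gamma>: "\<gamma> \<in> carrier SL2Z"
    and g: "\<And>v z. v \<in> V \<Longrightarrow> z \<in> uhp \<Longrightarrow> pullback_form (frac_lin \<gamma>) (\<omega> v) z = (\<Sum>u\<in>V. g v u * \<omega> u z)"
  shows "iter_lim V \<omega> (cusp_act \<gamma> b) (cusp_act \<gamma> a) = nc_subst V g (iter_lim V \<omega> b a)"
proof
  fix w show "iter_lim V \<omega> (cusp_act \<gamma> b) (cusp_act \<gamma> a) w = nc_subst V g (iter_lim V \<omega> b a) w"
  proof (cases "w \<in> lists V")
    case True
    have "((\<lambda>z. nc_subst V g (\<lambda>x. iter_prim \<omega> b x z) w) \<longlongrightarrow> nc_subst V g (iter_lim V \<omega> b a) w) (cusp_nhds a)"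
      by (intro nc_subst_tendsto iter_prim_lim)
    moreover have "\<forall>\<^sub>F z in cusp_nhds a. nc_subst V g (\<lambda>x. iter_prim \<omega> b x z) w =
        iter_prim \<omega> (cusp_act \<gamma> b) w (frac_lin \<gamma> z)"
      using eventually_cusp_nhds_uhp
      by eventually_elim (rule iter_prim_equivariant[OF \<gamma> g True, symmetric])
    ultimately have "((\<lambda>z. iter_prim \<omega> (cusp_act \<gamma> b) w (frac_lin \<gamma> z)) \<longlongrightarrow>
        nc_subst V g (iter_lim V \<omega> b a) w) (cusp_nhds a)"
      by (rule Lim_transform_eventually)
    then show ?thesis
      by (intro iter_lim_eqI[OF True]) (simp add: cusp_nhds_act[OF \<gamma>] filterlim_filtermap)
  next
    case False
    then show ?thesis using nc_subst_carrier[of V g "iter_lim V \<omega> b a"]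
      by (simp add: nc_ring_simps iter_lim_def)
  qed
qed

end

section \<open>Integration over simplices\<close>

text \<open>In the numbering \<open>1 > t\<^sub>1 > \<dots> > t\<^sub>n > 0\<close> this is \<open>t\<^sub>n\<close> with the convention \<open>t\<^sub>0 = 1\<close>, so that a
  further coordinate ranges over an interval from \<open>0\<close> to it in every dimension.\<close>

definition last_bound :: "nat \<Rightarrow> (nat \<Rightarrow> real) \<Rightarrow> real" where
  "last_bound n t = (if n = 0 then 1 else t (n - 1))"

lemma open_simplex_Suc:
  "x(n := y) \<in> open_simplex (Suc n) \<longleftrightarrow> x \<in> open_simplex n \<and> 0 < y \<and> y < last_bound n x"
proof (cases n)
  case 0
  then show ?thesis by (auto simp: open_simplex_def last_bound_def)
next
  case (Suc m)
  show ?thesis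
  proof
    assume L: "x(n := y) \<in> open_simplex (Suc n)"
    have m: "m < Suc n" "n < Suc n" "m < n" using Suc by auto
    then have "(x(n := y)) n < (x(n := y)) m" "0 < (x(n := y)) n"
      using L unfolding open_simplex_def by blast+
    then have "y < x m" "0 < y" using m by simp_all
    moreover have "x \<in> open_simplex n"
      unfolding open_simplex_def
    proof (intro CollectI conjI allI impI)
      fix i j assume ij: "i < n" "j < n" "i < j"
      have "(x(n := y)) j < (x(n := y)) i"
        using L ij unfolding open_simplex_def by (blast intro: less_SucI)
      then show "x j < x i" using ij by simp
    next
      fix i assume "i < n"
      moreover have "0 < (x(n := y)) i \<and> (x(n := y)) i < 1"
        using L \<open>i < n\<close> unfolding open_simplex_def by (blast intro: less_SucI)
      ultimately show "0 < x i" "x i < 1" by simp_all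
    qed
    ultimately show "x \<in> open_simplex n \<and> 0 < y \<and> y < last_bound n x"
      using Suc by (simp add: last_bound_def)
  next
    assume R: "x \<in> open_simplex n \<and> 0 < y \<and> y < last_bound n x"
    have x: "\<And>i. i < n \<Longrightarrow> 0 < x i \<and> x i < 1" "\<And>i j. i < n \<Longrightarrow> j < n \<Longrightarrow> i < j \<Longrightarrow> x j < x i"
      using R by (auto simp: open_simplex_def)
    have yx: "y < x i" if "i < n" for i
      using that x(2)[of i m] R Suc by (cases "i = m") (auto simp: last_bound_def)
    have "y < 1" using yx[of m] x(1)[of m] Suc by auto
    then show "x(n := y) \<in> open_simplex (Suc n)"
      using R x yx by (auto simp: open_simplex_def less_Suc_eq)
  qed
qed

lemma measurable_open_simplex:
  "Measurable.pred (PiM {..<n} (\<lambda>_. lborel)) (\<lambda>t. t \<in> open_simplex n)"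
proof -
  have comp: "(\<lambda>t. t i) \<in> borel_measurable (PiM {..<n} (\<lambda>_. lborel :: real measure))" if "i < n" for i
    using measurable_component_singleton[of i "{..<n}" "\<lambda>_. lborel"] that by simp
  have "Measurable.pred (PiM {..<n} (\<lambda>_. lborel)) (\<lambda>t :: nat \<Rightarrow> real.
      (\<forall>i\<in>{..<n}. 0 < t i \<and> t i < 1) \<and> (\<forall>i\<in>{..<n}. \<forall>j\<in>{..<n}. i < j \<longrightarrow> t j < t i))"
    by (intro pred_intros_logic pred_intros_finite finite_lessThan borel_measurable_pred_less comp)
       auto
  then show ?thesis by (simp add: open_simplex_def Ball_def)
qed

lemma inner_integral_measurable_bounded:
  fixes \<phi> g :: "real \<Rightarrow> complex"
  assumes \<phi>: "integrable lborel \<phi>" and g: "g \<in> borel_measurable borel" "\<And>x. cmod (g x) \<le> B"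
  shows "(\<lambda>x. LINT y:{0<..<x}|lborel. \<phi> y * g y) \<in> borel_measurable borel"
    and "cmod (LINT y:{0<..<x}|lborel. \<phi> y * g y) \<le> (LINT y|lborel. cmod (\<phi> y) * B)"
proof -
  have [measurable]: "\<phi> \<in> borel_measurable borel" "g \<in> borel_measurable borel" using \<phi> g by auto
  have "(\<lambda>x. LINT y|lborel. (if 0 < y \<and> y < x then \<phi> y * g y else 0)) \<in> borel_measurable borel"
    by measurable
  also have "(\<lambda>x. LINT y|lborel. (if 0 < y \<and> y < x then \<phi> y * g y else 0)) =
      (\<lambda>x. LINT y:{0<..<x}|lborel. \<phi> y * g y)"
    unfolding set_lebesgue_integral_def by (intro ext Bochner_Integration.integral_cong) auto
  finally show "(\<lambda>x. LINT y:{0<..<x}|lborel. \<phi> y * g y) \<in> borel_measurable borel" .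
  have "cmod (LINT y:{0<..<x}|lborel. \<phi> y * g y) \<le>
      (LINT y|lborel. norm (indicator {0<..<x} y *\<^sub>R (\<phi> y * g y)))"
    unfolding set_lebesgue_integral_def by (rule integral_norm_bound)
  also have "\<dots> \<le> (LINT y|lborel. cmod (\<phi> y) * B)"
  proof (rule integral_mono')
    have B: "0 \<le> B" using order.trans[OF norm_ge_zero g(2)] .
    show "integrable lborel (\<lambda>y. cmod (\<phi> y) * B)" using \<phi> by (intro integrable_mult_left) auto
    show "0 \<le> cmod (\<phi> y) * B" for y using B by simp
    show "norm (indicator {0<..<x} y *\<^sub>R (\<phi> y * g y)) \<le> cmod (\<phi> y) * B" for y
      using B g(2)[of y] by (auto simp: norm_mult indicator_def intro: mult_left_mono)
  qed
  finally show "cmod (LINT y:{0<..<x}|lborel. \<phi> y * g y) \<le> (LINT y|lborel. cmod (\<phi> y) * B)" .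
qed

text \<open>Fubini, integrating out the smallest coordinate first.  The weight \<open>g\<close> in that coordinate is
  there for the induction: the inner integral becomes the weight for the remaining coordinates.\<close>

lemma simplex_integral_foldr:
  fixes \<phi>s :: "(real \<Rightarrow> complex) list"
  assumes "\<And>\<phi>. \<phi> \<in> set \<phi>s \<Longrightarrow> integrable lborel \<phi>"
    and "g \<in> borel_measurable borel" "\<And>x. cmod (g x) \<le> B"
  shows "(\<integral>t. indicator (open_simplex (length \<phi>s)) t *\<^sub>R
      ((\<Prod>i<length \<phi>s. (\<phi>s ! i) (t i)) * g (last_bound (length \<phi>s) t)) \<partial>PiM {..<length \<phi>s} (\<lambda>_. lborel)) =
    foldr (\<lambda>\<phi> h x. LINT y:{0<..<x}|lborel. \<phi> y * h y) \<phi>s g 1"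
  using assms
proof (induction \<phi>s arbitrary: g B rule: rev_induct)
  case Nil
  have "open_simplex 0 = UNIV" by (simp add: open_simplex_def)
  then show ?case
    by (simp add: PiM_empty lebesgue_integral_count_space_finite last_bound_def)
next
  case (snoc \<phi> \<psi>s)
  interpret product_sigma_finite "\<lambda>_ :: nat. lborel :: real measure" by standard
  define n where "n = length \<psi>s"
  let ?M = "\<lambda>n. PiM {..<n} (\<lambda>_ :: nat. lborel :: real measure)"
  define \<Phi> where "\<Phi> = (\<lambda>x. LINT y:{0<..<x}|lborel. \<phi> y * g y)"
  define f where "f t = indicator (open_simplex (Suc n)) t *\<^sub>R
      ((\<Prod>i<Suc n. ((\<psi>s @ [\<phi>]) ! i) (t i)) * g (last_bound (Suc n) t))" for t
  have \<phi>: "integrable lborel \<phi>" using snoc.prems by auto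
  have "integrable (?M (Suc n)) (\<lambda>t. \<Prod>i<Suc n. ((\<psi>s @ [\<phi>]) ! i) (t i))"
    by (rule product_integrable_prod) (auto intro!: snoc.prems simp: n_def nth_append less_Suc_eq)
  then have bound_int: "integrable (?M (Suc n)) (\<lambda>t. B *\<^sub>R (\<Prod>i<Suc n. ((\<psi>s @ [\<phi>]) ! i) (t i)))"
    by (rule integrable_scaleR_right)
  have f_int: "integrable (?M (Suc n)) f"
  proof (rule Bochner_Integration.integrable_bound[OF bound_int])
    have "(\<lambda>t. t n) \<in> borel_measurable (?M (Suc n))"
      using measurable_component_singleton[of n "{..<Suc n}" "\<lambda>_. lborel"] by simp
    then have "(\<lambda>t. g (last_bound (Suc n) t)) \<in> borel_measurable (?M (Suc n))"
      using snoc.prems(2) by (simp add: last_bound_def)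
    moreover have "(\<lambda>t. indicator (open_simplex (Suc n)) t :: real) \<in> borel_measurable (?M (Suc n))"
      using measurable_open_simplex[of "Suc n"] by (simp add: borel_measurable_indicator_iff pred_def Int_def conj_commute)
    moreover have "(\<lambda>t. \<Prod>i<Suc n. ((\<psi>s @ [\<phi>]) ! i) (t i)) \<in> borel_measurable (?M (Suc n))"
      using \<open>integrable (?M (Suc n)) (\<lambda>t. \<Prod>i<Suc n. ((\<psi>s @ [\<phi>]) ! i) (t i))\<close> by (rule borel_measurable_integrable)
    ultimately show "f \<in> borel_measurable (?M (Suc n))"
      unfolding f_def by (intro borel_measurable_scaleR borel_measurable_times)
    have B: "0 \<le> B" using order.trans[OF norm_ge_zero snoc.prems(3)] .
    have "norm (f t) \<le> norm (B *\<^sub>R (\<Prod>i<Suc n. ((\<psi>s @ [\<phi>]) ! i) (t i)))" for t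
    proof -
      define p where "p = (\<Prod>i<Suc n. ((\<psi>s @ [\<phi>]) ! i) (t i))"
      have "norm (f t) \<le> norm p * norm (g (last_bound (Suc n) t))"
        unfolding f_def p_def[symmetric] by (simp add: norm_mult indicator_def)
      also have "\<dots> \<le> norm p * B" by (intro mult_left_mono snoc.prems(3)) simp
      finally show ?thesis unfolding p_def[symmetric] using B by (simp add: mult.commute)
    qed
    then show "AE t in ?M (Suc n). norm (f t) \<le> norm (B *\<^sub>R (\<Prod>i<Suc n. ((\<psi>s @ [\<phi>]) ! i) (t i)))" by simp
  qed
  have inner: "(\<integral>y. f (x(n := y)) \<partial>lborel) = indicator (open_simplex n) x *\<^sub>R
      ((\<Prod>i<n. (\<psi>s ! i) (x i)) * \<Phi> (last_bound n x))" for x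
  proof -
    have pt: "f (x(n := y)) = (indicator (open_simplex n) x *\<^sub>R (\<Prod>i<n. (\<psi>s ! i) (x i))) *
        (indicator {0<..<last_bound n x} y *\<^sub>R (\<phi> y * g y))" for y
    proof -
      have "(\<Prod>i<n. ((\<psi>s @ [\<phi>]) ! i) ((x(n := y)) i)) = (\<Prod>i<n. (\<psi>s ! i) (x i))"
        by (rule prod.cong) (auto simp: n_def nth_append)
      then have p: "(\<Prod>i<Suc n. ((\<psi>s @ [\<phi>]) ! i) ((x(n := y)) i)) = (\<Prod>i<n. (\<psi>s ! i) (x i)) * \<phi> y"
        by (simp add: n_def)
      have l: "last_bound (Suc n) (x(n := y)) = y" by (simp add: last_bound_def)
      show ?thesis unfolding f_def p l
        by (auto simp: indicator_def open_simplex_Suc)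
    qed
    show ?thesis unfolding pt integral_mult_right_zero by (simp add: \<Phi>_def set_lebesgue_integral_def)
  qed
  have "(\<integral>t. f t \<partial>?M (Suc n)) = (\<integral>x. (\<integral>y. f (x(n := y)) \<partial>lborel) \<partial>?M n)"
    using product_integral_insert[of "{..<n}" n f] f_int by (simp add: lessThan_Suc)
  also have "\<dots> = foldr (\<lambda>\<phi> h x. LINT y:{0<..<x}|lborel. \<phi> y * h y) \<psi>s \<Phi> 1"
    unfolding inner unfolding n_def
    by (rule snoc.IH)
       (use snoc.prems inner_integral_measurable_bounded[OF \<phi> snoc.prems(2,3)] in \<open>auto simp: \<Phi>_def\<close>)
  finally show ?case by (simp add: f_def[abs_def] n_def \<Phi>_def)
qed

lemma integral_Ioo_FTC:
  fixes G h :: "real \<Rightarrow> complex"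
  assumes x: "0 < x" and G: "\<And>t. 0 < t \<Longrightarrow> t < x \<Longrightarrow> (G has_vector_derivative h t) (at t)"
    and h: "\<And>t. 0 < t \<Longrightarrow> t < x \<Longrightarrow> isCont h t" "set_integrable lborel {0<..<x} h"
    and lim: "(G \<longlongrightarrow> A) (at_right 0)" "(G \<longlongrightarrow> B) (at_left x)"
  shows "(LINT y:{0<..<x}|lborel. h y) = B - A"
proof -
  have "(LBINT y=ereal 0..ereal x. h y) = B - A"
  proof (rule interval_integral_FTC_integrable)
    show "set_integrable lborel (einterval (ereal 0) (ereal x)) h" using h(2) by simp
    show "((G \<circ> real_of_ereal) \<longlongrightarrow> A) (at_right (ereal 0))" "((G \<circ> real_of_ereal) \<longlongrightarrow> B) (at_left (ereal x))"
      unfolding ereal_tendsto_simps by (fact lim)+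
  qed (use x G h in auto)
  then show ?thesis using x by (subst (asm) interval_integral_Ioo) auto
qed

lemma bounded_Ioo:
  fixes h :: "real \<Rightarrow> complex"
  assumes h: "continuous_on {0<..<1} h"
    and "\<forall>\<^sub>F t in at_right 0. cmod (h t) \<le> C1" "\<forall>\<^sub>F t in at_left 1. cmod (h t) \<le> C2"
  shows "\<exists>C. \<forall>t\<in>{0<..<1}. cmod (h t) \<le> C"
proof -
  obtain d1 where d1: "d1 > 0" "\<And>t. 0 < t \<Longrightarrow> t < d1 \<Longrightarrow> cmod (h t) \<le> C1"
    using assms(2) by (auto simp: eventually_at_right_field)
  obtain d2 where d2: "d2 < 1" "\<And>t. d2 < t \<Longrightarrow> t < 1 \<Longrightarrow> cmod (h t) \<le> C2"
    using assms(3) by (auto simp: eventually_at_left_field)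
  define a b where "a = min d1 (1/2)" and "b = max d2 (1/2)"
  have ab: "0 < a" "a \<le> d1" "b < 1" "d2 \<le> b" using d1(1) d2(1) by (auto simp: a_def b_def)
  have "compact (h ` {a..b})"
    using ab by (intro compact_continuous_image continuous_on_subset[OF h]) auto
  then have "bounded (h ` {a..b})" by (rule compact_imp_bounded)
  then obtain C3 where "\<forall>y\<in>h ` {a..b}. cmod y \<le> C3" unfolding bounded_iff ..
  then have C3: "\<And>t. t \<in> {a..b} \<Longrightarrow> cmod (h t) \<le> C3" by simp
  have "cmod (h t) \<le> max C1 (max C2 C3)" if "t \<in> {0<..<1}" for t
  proof -
    consider "t < d1" | "t > d2" | "t \<in> {a..b}" using ab by fastforce
    then show ?thesis using that d1(2)[of t] d2(2)[of t] C3[of t] by cases auto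
  qed
  then show ?thesis by blast
qed

lemma set_integrable_bounded_Ioo:
  fixes h :: "real \<Rightarrow> complex"
  assumes "continuous_on {0<..<1} h" "\<And>t. t \<in> {0<..<1} \<Longrightarrow> cmod (h t) \<le> C" "x \<le> 1"
  shows "set_integrable lborel {0<..<x} h"
proof -
  have "set_integrable lborel {0<..<1 :: real} (\<lambda>_. complex_of_real C)"
    unfolding set_integrable_def by simp
  then have "set_integrable lborel {0<..<1} h"
  proof (rule set_integrable_bound)
    show "set_borel_measurable lborel {0<..<1} h"
      using assms(1) unfolding set_borel_measurable_def
      by (simp add: borel_measurable_continuous_on_indicator)
  qed (use assms(2) in \<open>auto simp: order.trans[OF _ abs_ge_self]\<close>)
  then show ?thesis by (rule set_integrable_subset) (use assms(3) in auto)
qed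

section \<open>Geodesics between cusps\<close>

lemma of_rat_complex: "(of_rat q :: complex) = of_real (of_rat q)"
  by (cases q) (simp add: of_rat_rat)

fun geodesic_deriv :: "cusp \<Rightarrow> cusp \<Rightarrow> real \<Rightarrow> complex" where
  "geodesic_deriv (Cusp b) (Cusp a) t =
     Complex (- (of_rat b - of_rat a) / 2 * pi * sin (pi * t)) (\<bar>of_rat a - of_rat b\<bar> / 2 * pi * cos (pi * t))"
| "geodesic_deriv (Cusp b) Cusp_Infinity t = Complex 0 (1 / (1 - t)\<^sup>2)"
| "geodesic_deriv Cusp_Infinity (Cusp a) t = Complex 0 (- 1 / t\<^sup>2)"
| "geodesic_deriv Cusp_Infinity Cusp_Infinity t = 0"

lemma geodesic_has_deriv:
  assumes "b \<noteq> a" "0 < t" "t < 1"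
  shows "(geodesic b a has_vector_derivative geodesic_deriv b a t) (at t)"
  using assms
  by (cases b; cases a)
     (auto simp: has_vector_derivative_complex_iff power2_eq_square divide_simps
           intro!: derivative_eq_intros, auto simp: algebra_simps)

lemma geodesic_uhp:
  assumes "b \<noteq> a" "0 < t" "t < 1"
  shows "geodesic b a t \<in> uhp"
  using assms sin_gt_zero[of "pi * t"]
  by (cases b; cases a) (auto simp: uhp_iff of_rat_eq_iff)

lemma continuous_geodesic_deriv: "b \<noteq> a \<Longrightarrow> continuous_on {0<..<1} (geodesic_deriv b a)"
proof -
  assume ba: "b \<noteq> a"
  have "geodesic_deriv b a = (\<lambda>t. Complex (Re (geodesic_deriv b a t)) (Im (geodesic_deriv b a t)))"
    by simp
  moreover have "continuous_on {0<..<1} (\<lambda>t. Re (geodesic_deriv b a t))"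
    "continuous_on {0<..<1} (\<lambda>t. Im (geodesic_deriv b a t))"
    using ba by (cases b; cases a; auto intro!: continuous_intros)+
  ultimately show ?thesis by (metis continuous_on_Complex)
qed

text \<open>By reversal, only the behaviour at the starting point has to be examined.\<close>

lemma geodesic_reverse:
  assumes "b \<noteq> a"
  shows "geodesic b a t = geodesic a b (1 - t)" "geodesic_deriv b a t = - geodesic_deriv a b (1 - t)"
proof -
  have "cos (pi * (1 - t)) = - cos (pi * t)" "sin (pi * (1 - t)) = sin (pi * t)"
    by (simp_all add: right_diff_distrib cos_diff sin_diff)
  then show "geodesic b a t = geodesic a b (1 - t)" "geodesic_deriv b a t = - geodesic_deriv a b (1 - t)"
    using assms by (cases b; cases a; simp add: complex_eq_iff algebra_simps abs_minus_commute diff_divide_distrib)+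
qed

lemma filterlim_at_top_cong:
  "filterlim f at_top F \<Longrightarrow> \<forall>\<^sub>F t in F. f t = g t \<Longrightarrow> filterlim g at_top F"
  by (simp add: filterlim_cong[OF refl refl])

lemma filterlim_cusp_strip:
  assumes "\<forall>\<^sub>F t in F. \<bar>Re (f t)\<bar> \<le> K" "filterlim (\<lambda>t. Im (f t)) at_top F"
  shows "filterlim f cusp_strip F"
  unfolding filterlim_iff
proof (intro allI impI)
  fix P assume "eventually P cusp_strip"
  then obtain Y where Y: "\<And>z. \<bar>Re z\<bar> \<le> K \<Longrightarrow> Im z \<ge> Y \<Longrightarrow> P z"
    unfolding eventually_cusp_strip by meson
  have "\<forall>\<^sub>F t in F. Im (f t) \<ge> Y" using assms(2) by (simp add: filterlim_at_top)
  with assms(1) show "\<forall>\<^sub>F t in F. P (f t)" by eventually_elim (rule Y)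
qed

text \<open>Passing from the pull-back to the coefficient in the original coordinate costs a factor
  \<open>(c w + d)\<^sup>2\<close>, which is \<open>O((Im w)\<^sup>2)\<close> on a strip and is absorbed by the decay.\<close>

lemma cusp_decay_bounded:
  assumes F: "cusp_decay F" and A: "A \<in> carrier SL2Z"
    and w: "\<forall>\<^sub>F t in G. \<bar>Re (w t)\<bar> \<le> K" "filterlim (\<lambda>t. Im (w t)) at_top G"
  shows "\<exists>C. \<forall>\<^sub>F t in G. cmod (F (frac_lin A (w t))) \<le> C"
proof -
  obtain C Y where C: "\<And>z. \<bar>Re z\<bar> \<le> K \<Longrightarrow> Im z \<ge> Y \<Longrightarrow>
      cmod (F (frac_lin A z) / aut_factor A z ^ 2) \<le> C / (Im z)\<^sup>2"
    using F A unfolding cusp_decay_def by meson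
  define c where "c = \<bar>real_of_int (A $ 2 $ 1)\<bar> * (\<bar>K\<bar> + 1) + \<bar>real_of_int (A $ 2 $ 2)\<bar>"
  have "\<forall>\<^sub>F t in G. Im (w t) \<ge> max Y 1" using w(2) by (simp only: filterlim_at_top)
  with w(1) have "\<forall>\<^sub>F t in G. cmod (F (frac_lin A (w t))) \<le> \<bar>C\<bar> * c\<^sup>2"
  proof eventually_elim
    case (elim t)
    define z where "z = w t"
    have z: "\<bar>Re z\<bar> \<le> K" "Im z \<ge> Y" "Im z \<ge> 1" using elim by (auto simp: z_def)
    define j where "j = aut_factor A z"
    have j: "j \<noteq> 0" unfolding j_def using z by (intro aut_factor_nonzero[OF A]) (simp add: uhp_iff)
    have "cmod z \<le> \<bar>Re z\<bar> + \<bar>Im z\<bar>" by (rule cmod_le)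
    also have "\<dots> \<le> \<bar>K\<bar> * Im z + Im z"
      using z mult_left_mono[of 1 "Im z" "\<bar>K\<bar>"] by linarith
    finally have "cmod z \<le> (\<bar>K\<bar> + 1) * Im z" by (simp add: algebra_simps)
    then have "\<bar>real_of_int (A $ 2 $ 1)\<bar> * cmod z + \<bar>real_of_int (A $ 2 $ 2)\<bar>
        \<le> \<bar>real_of_int (A $ 2 $ 1)\<bar> * ((\<bar>K\<bar> + 1) * Im z) + \<bar>real_of_int (A $ 2 $ 2)\<bar> * Im z"
      using z(3) mult_left_mono[of 1 "Im z" "\<bar>real_of_int (A $ 2 $ 2)\<bar>"] by (intro add_mono mult_left_mono) auto
    moreover have "cmod j \<le> \<bar>real_of_int (A $ 2 $ 1)\<bar> * cmod z + \<bar>real_of_int (A $ 2 $ 2)\<bar>"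
      unfolding j_def aut_factor_def by (metis norm_mult norm_of_int norm_triangle_ineq)
    ultimately have jb: "cmod j \<le> c * Im z" by (simp add: c_def algebra_simps)
    have "cmod (F (frac_lin A z)) = cmod (F (frac_lin A z) / j ^ 2) * cmod j ^ 2"
      using j by (simp add: norm_divide norm_power)
    also have "\<dots> \<le> (\<bar>C\<bar> / (Im z)\<^sup>2) * (c * Im z)\<^sup>2"
    proof (intro mult_mono power_mono jb)
      show "cmod (F (frac_lin A z) / j ^ 2) \<le> \<bar>C\<bar> / (Im z)\<^sup>2"
        using order.trans[OF C[OF z(1,2)], of "\<bar>C\<bar> / (Im z)\<^sup>2"] by (simp add: j_def divide_right_mono)
    qed auto
    also have "\<dots> = \<bar>C\<bar> * c\<^sup>2" using z(3) by (simp add: power_mult_distrib)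
    finally show ?case by (simp add: z_def)
  qed
  then show ?thesis ..
qed

text \<open>In the coordinate \<open>w = -d/c - 1/(c\<^sup>2 (z - \<beta>))\<close> at the cusp \<open>\<beta>\<close>, approach to infinity in a
  strip is a condition on \<open>1 / (z - \<beta>)\<close>.\<close>

lemma approach_finite_cusp:
  assumes z: "\<forall>\<^sub>F t in G. z t \<in> uhp" "\<forall>\<^sub>F t in G. \<bar>Re (1 / (z t - of_rat \<beta>))\<bar> \<le> K"
    and lim: "filterlim (\<lambda>t. - Im (1 / (z t - of_rat \<beta>))) at_top G"
  shows "filterlim z (cusp_nhds (Cusp \<beta>)) G"
    and "cusp_decay F \<Longrightarrow> \<exists>C. \<forall>\<^sub>F t in G. cmod (F (z t)) \<le> C"
proof -
  obtain A where A: "A \<in> carrier SL2Z" "cusp_act A Cusp_Infinity = Cusp \<beta>" by (rule cusp_transitive)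
  define c where "c = real_of_int (A $ 2 $ 1)"
  define a where "a = real_of_int (A $ 1 $ 1)"
  define d where "d = real_of_int (A $ 2 $ 2)"
  define b where "b = real_of_int (A $ 1 $ 2)"
  have c0: "A $ 2 $ 1 \<noteq> 0" and \<beta>: "\<beta> = of_int (A $ 1 $ 1) / of_int (A $ 2 $ 1)"
    using A(2) by (auto split: if_splits)
  have c: "c \<noteq> 0" using c0 by (simp add: c_def)
  have \<beta>': "(of_rat \<beta> :: complex) = of_real (a / c)"
    by (simp add: \<beta> of_rat_divide a_def c_def)
  have det: "a * d - b * c = 1"
    unfolding a_def b_def c_def d_def by (rule SL2Z_det_complex[OF A(1)])
  define w where "w = (\<lambda>t. frac_lin (adj A) (z t))"
  have w_eq: "w t = of_real (- d / c) - of_real (1 / c\<^sup>2) * (1 / (z t - of_rat \<beta>))" if "z t \<in> uhp" for t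
  proof -
    have nz: "z t - of_real (a / c) \<noteq> 0" using that by (auto simp: uhp_iff complex_eq_iff)
    then have nz': "- of_real c * z t + of_real a \<noteq> 0" using c by (simp add: field_simps)
    have "w t = (of_real d * z t - of_real b) / (- of_real c * z t + of_real a)"
      by (simp add: w_def frac_lin_def aut_factor_def adj_def a_def b_def c_def d_def)
    also have "of_real d * z t - of_real b =
        of_real (- d / c) * (- of_real c * z t + of_real a) + of_real ((a * d - b * c) / c)"
      using c by (simp add: field_simps)
    also have "\<dots> / (- of_real c * z t + of_real a) =
        of_real (- d / c) + of_real (1 / c) / (- of_real c * z t + of_real a)"
      unfolding det add_divide_distrib using nz' by (subst nonzero_mult_div_cancel_right) simp_all
    also have "- of_real c * z t + of_real a = - of_real c * (z t - of_real (a / c))"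
      using c by (simp add: field_simps)
    finally show ?thesis using c by (simp add: \<beta>' power2_eq_square)
  qed
  have zw: "\<forall>\<^sub>F t in G. frac_lin A (w t) = z t"
    using z(1) by eventually_elim (simp add: w_def frac_lin_adj A(1))
  have Re_w: "\<forall>\<^sub>F t in G. \<bar>Re (w t)\<bar> \<le> \<bar>d / c\<bar> + (1 / c\<^sup>2) * K"
    using z
  proof eventually_elim
    case (elim t)
    have "Re (w t) = - d / c - (1 / c\<^sup>2) * Re (1 / (z t - of_rat \<beta>))"
      unfolding w_eq[OF elim(1)] minus_complex.sel times_complex.sel Re_complex_of_real Im_complex_of_real
      by simp
    moreover have "\<bar>(1 / c\<^sup>2) * Re (1 / (z t - of_rat \<beta>))\<bar> \<le> (1 / c\<^sup>2) * K"
      unfolding abs_mult using elim(2) by (intro mult_mono) auto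
    moreover have "\<bar>- d / c\<bar> = \<bar>d / c\<bar>" by simp
    ultimately show ?case
      using abs_triangle_ineq4[of "- d / c" "(1 / c\<^sup>2) * Re (1 / (z t - of_rat \<beta>))"] by linarith
  qed
  have "filterlim (\<lambda>t. (1 / c\<^sup>2) * (- Im (1 / (z t - of_rat \<beta>)))) at_top G"
    using c by (intro filterlim_tendsto_pos_mult_at_top[OF tendsto_const _ lim]) simp
  moreover have "\<forall>\<^sub>F t in G. (1 / c\<^sup>2) * (- Im (1 / (z t - of_rat \<beta>))) = Im (w t)"
    using z(1)
  proof eventually_elim
    case (elim t)
    show ?case
      unfolding w_eq[OF elim(1)] minus_complex.sel times_complex.sel Re_complex_of_real Im_complex_of_real
      by simp
  qed
  ultimately have Im_w: "filterlim (\<lambda>t. Im (w t)) at_top G"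
    by (rule filterlim_at_top_cong)
  have "filterlim (\<lambda>t. frac_lin A (w t)) (filtermap (frac_lin A) cusp_strip) G"
    by (rule filterlim_compose[OF _ filterlim_cusp_strip[OF Re_w Im_w]]) (simp add: filterlim_def)
  then show "filterlim z (cusp_nhds (Cusp \<beta>)) G"
    unfolding A(2)[symmetric] cusp_nhds_eq[OF A(1)] using filterlim_cong[OF refl refl zw] by simp
  show "\<exists>C. \<forall>\<^sub>F t in G. cmod (F (z t)) \<le> C" if F: "cusp_decay F"
  proof -
    obtain C where "\<forall>\<^sub>F t in G. cmod (F (frac_lin A (w t))) \<le> C"
      using cusp_decay_bounded[OF F A(1) Re_w Im_w] by blast
    with zw have "\<forall>\<^sub>F t in G. cmod (F (z t)) \<le> C" by eventually_elim simp
    then show ?thesis ..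
  qed
qed

lemma approach_infinity:
  assumes z: "\<forall>\<^sub>F t in G. \<bar>Re (z t)\<bar> \<le> K" and lim: "filterlim (\<lambda>t. Im (z t)) at_top G"
  shows "filterlim z (cusp_nhds Cusp_Infinity) G"
    and "cusp_decay F \<Longrightarrow> \<exists>C. \<forall>\<^sub>F t in G. cmod (F (z t)) \<le> C / (Im (z t))\<^sup>2"
proof -
  have one: "mat 1 \<in> carrier SL2Z" by (simp add: SL2Z_iff mat_2)
  have "cusp_nhds Cusp_Infinity = filtermap (frac_lin (mat 1)) cusp_strip"
    using cusp_nhds_eq[OF one] by (simp add: cusp_act_one del: cusp_act.simps)
  moreover have "frac_lin (mat 1) = (\<lambda>z. z)" by (rule ext) simp
  ultimately show "filterlim z (cusp_nhds Cusp_Infinity) G"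
    using filterlim_cusp_strip[OF z lim] by (simp add: filtermap_ident)
  show "\<exists>C. \<forall>\<^sub>F t in G. cmod (F (z t)) \<le> C / (Im (z t))\<^sup>2" if dec: "cusp_decay F"
  proof -
    obtain C Y where C: "\<And>z. \<bar>Re z\<bar> \<le> K \<Longrightarrow> Im z \<ge> Y \<Longrightarrow>
        cmod (F (frac_lin (mat 1) z) / aut_factor (mat 1) z ^ 2) \<le> C / (Im z)\<^sup>2"
      using dec[unfolded cusp_decay_def, THEN conjunct2, THEN bspec, OF one, THEN spec, of K]
      by blast
    have "\<forall>\<^sub>F t in G. Im (z t) \<ge> Y" using lim by (simp only: filterlim_at_top)
    with z have "\<forall>\<^sub>F t in G. cmod (F (z t)) \<le> C / (Im (z t))\<^sup>2"
      by eventually_elim (use C in \<open>simp add: aut_factor_def mat_2\<close>)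
    then show ?thesis ..
  qed
qed

lemma at_right_0_unit: "\<forall>\<^sub>F t :: real in at_right 0. 0 < t \<and> t < 1/2"
  unfolding eventually_at_right_field by (intro exI[of _ "1/2"]) auto

text \<open>On the half circle from \<open>\<beta>\<close> to \<open>\<alpha>\<close> the real part of \<open>1 / (z - \<beta>)\<close> is the constant
  \<open>1 / (\<alpha> - \<beta>)\<close>, as inversion at \<open>\<beta>\<close> takes this circle to a vertical line.\<close>

lemma geodesic_start:
  assumes ba: "b \<noteq> a"
  shows "filterlim (geodesic b a) (cusp_nhds b) (at_right 0)"
    and "cusp_decay F \<Longrightarrow> \<exists>C. \<forall>\<^sub>F t in at_right 0. cmod (F (geodesic b a t) * geodesic_deriv b a t) \<le> C"
proof -
  let ?\<delta> = "geodesic b a" and ?\<delta>' = "geodesic_deriv b a"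
  have uhp: "\<forall>\<^sub>F t in at_right 0. ?\<delta> t \<in> uhp"
    using at_right_0_unit by eventually_elim (rule geodesic_uhp[OF ba], auto)
  have "filterlim ?\<delta> (cusp_nhds b) (at_right 0) \<and>
    (cusp_decay F \<longrightarrow> (\<exists>C. \<forall>\<^sub>F t in at_right 0. cmod (F (?\<delta> t) * ?\<delta>' t) \<le> C))"
  proof (cases b)
    case (Cusp \<beta>)
    define D where "D = (case a of Cusp_Infinity \<Rightarrow> 4 | Cusp \<alpha> \<Rightarrow> \<bar>of_rat \<beta> - of_rat \<alpha> :: real\<bar> * pi)"
    have D: "\<forall>\<^sub>F t in at_right 0. cmod (?\<delta>' t) \<le> D"
      using at_right_0_unit
    proof eventually_elim
      case (elim t)
      show ?case
      proof (cases a)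
        case Cusp_Infinity
        have "1 / (1 - t)\<^sup>2 \<le> 1 / (1/2)\<^sup>2"
          using elim by (intro divide_left_mono power_mono mult_pos_pos) auto
        moreover have "cmod (?\<delta>' t) = 1 / (1 - t)\<^sup>2" by (simp add: Cusp Cusp_Infinity cmod_def)
        ultimately show ?thesis by (simp add: D_def Cusp_Infinity power2_eq_square)
      next
        case a: (Cusp \<alpha>)
        define R where "R = \<bar>of_rat \<beta> - of_rat \<alpha> :: real\<bar> / 2 * pi"
        have R: "R \<ge> 0" by (simp add: R_def)
        have "cmod (?\<delta>' t) \<le> \<bar>Re (?\<delta>' t)\<bar> + \<bar>Im (?\<delta>' t)\<bar>" by (rule cmod_le)
        also have "\<dots> = R * \<bar>sin (pi * t)\<bar> + R * \<bar>cos (pi * t)\<bar>"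
          by (simp add: Cusp a R_def abs_mult abs_minus_commute)
        also have "\<dots> \<le> R * 1 + R * 1"
          by (intro add_mono mult_left_mono R) auto
        finally show ?thesis by (simp add: D_def a R_def mult.commute)
      qed
    qed
    obtain K where K: "\<forall>\<^sub>F t in at_right 0. \<bar>Re (1 / (?\<delta> t - of_rat \<beta>))\<bar> \<le> K"
      and lim: "filterlim (\<lambda>t. - Im (1 / (?\<delta> t - of_rat \<beta>))) at_top (at_right 0)"
    proof (cases a)
      case Cusp_Infinity
      have eq: "\<forall>\<^sub>F t in at_right 0. 1 / (?\<delta> t - of_rat \<beta>) = Complex 0 (- ((1 - t) / t))"
        using at_right_0_unit
      proof eventually_elim
        case (elim t)
        have "?\<delta> t - of_rat \<beta> = Complex 0 (t / (1 - t))"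
          by (simp add: Cusp Cusp_Infinity complex_eq_iff of_rat_complex)
        then show ?case using elim by (simp add: complex_eq_iff Re_divide Im_divide power2_eq_square)
      qed
      have "filterlim (\<lambda>t :: real. (1 - t) / t) at_top (at_right 0)" by real_asymp
      moreover have "\<forall>\<^sub>F t in at_right 0. (1 - t) / t = - Im (1 / (?\<delta> t - of_rat \<beta>))"
        using eq by eventually_elim simp
      ultimately have "filterlim (\<lambda>t. - Im (1 / (?\<delta> t - of_rat \<beta>))) at_top (at_right 0)"
        by (rule filterlim_at_top_cong)
      moreover have "\<forall>\<^sub>F t in at_right 0. \<bar>Re (1 / (?\<delta> t - of_rat \<beta>))\<bar> \<le> 0"
        using eq by eventually_elim simp
      ultimately show ?thesis using that by blast
    next
      case a: (Cusp \<alpha>)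
      define R where "R = (of_rat \<beta> - of_rat \<alpha> :: real) / 2"
      have R: "R \<noteq> 0" using ba by (simp add: R_def Cusp a)
      have eq: "\<forall>\<^sub>F t in at_right 0. 1 / (?\<delta> t - of_rat \<beta>) =
          Complex (- 1 / (2 * R)) (- (1 / (2 * \<bar>R\<bar>) * (sin (pi * t) / (1 - cos (pi * t)))))"
        using at_right_0_unit
      proof eventually_elim
        case (elim t)
        define s c where "s = sin (pi * t)" and "c = cos (pi * t)"
        have sc: "s\<^sup>2 = (1 - c) * (1 + c)" using sin_cos_squared_add[of "pi * t"]
          by (simp add: s_def c_def power2_eq_square algebra_simps)
        have "c < 1"
          using elim cos_monotone_0_pi[of 0 "pi * t"] by (simp add: c_def)
        have "?\<delta> t - of_rat \<beta> = Complex (- R * (1 - c)) (\<bar>R\<bar> * s)"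
        proof -
          have "\<bar>of_rat \<alpha> - of_rat \<beta> :: real\<bar> / 2 = \<bar>R\<bar>" by (simp add: R_def abs_minus_commute)
          then have "?\<delta> t = Complex ((of_rat \<alpha> + of_rat \<beta>) / 2 + R * c) (\<bar>R\<bar> * s)"
            unfolding Cusp a geodesic.simps R_def s_def c_def by simp
          then show ?thesis by (simp add: complex_eq_iff of_rat_complex) (simp add: R_def field_simps)
        qed
        moreover have "(- R * (1 - c))\<^sup>2 + (\<bar>R\<bar> * s)\<^sup>2 = 2 * R\<^sup>2 * (1 - c)"
          unfolding power_mult_distrib sc by (simp add: power2_eq_square algebra_simps)
        moreover have "- R * (1 - c) / (2 * R\<^sup>2 * (1 - c)) = - 1 / (2 * R)"
          using R \<open>c < 1\<close> by (simp add: power2_eq_square)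
        moreover have "\<bar>R\<bar> * s / (2 * R\<^sup>2 * (1 - c)) = 1 / (2 * \<bar>R\<bar>) * (s / (1 - c))"
          using R \<open>c < 1\<close> by (simp add: power2_eq_square abs_if)
        ultimately show ?case
          unfolding s_def[symmetric] c_def[symmetric]
          by (simp only: complex_eq_iff Re_divide Im_divide complex.sel one_complex.sel) simp
      qed
      have "filterlim (\<lambda>t. sin (pi * t) / (1 - cos (pi * t))) at_top (at_right 0)" by real_asymp
      then have "filterlim (\<lambda>t. 1 / (2 * \<bar>R\<bar>) * (sin (pi * t) / (1 - cos (pi * t)))) at_top (at_right 0)"
        using R by (intro filterlim_tendsto_pos_mult_at_top[OF tendsto_const]) auto
      moreover have "\<forall>\<^sub>F t in at_right 0. 1 / (2 * \<bar>R\<bar>) * (sin (pi * t) / (1 - cos (pi * t))) =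
          - Im (1 / (?\<delta> t - of_rat \<beta>))"
        using eq by eventually_elim simp
      ultimately have "filterlim (\<lambda>t. - Im (1 / (?\<delta> t - of_rat \<beta>))) at_top (at_right 0)"
        by (rule filterlim_at_top_cong)
      moreover have "\<forall>\<^sub>F t in at_right 0. \<bar>Re (1 / (?\<delta> t - of_rat \<beta>))\<bar> \<le> \<bar>1 / (2 * R)\<bar>"
        using eq by eventually_elim simp
      ultimately show ?thesis using that by blast
    qed
    note app = approach_finite_cusp[OF uhp K lim]
    have "\<exists>C. \<forall>\<^sub>F t in at_right 0. cmod (F (?\<delta> t) * ?\<delta>' t) \<le> C" if dec: "cusp_decay F"
    proof -
      obtain C where "\<forall>\<^sub>F t in at_right 0. cmod (F (?\<delta> t)) \<le> C" using app(2)[OF dec] by blast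
      with D have "\<forall>\<^sub>F t in at_right 0. cmod (F (?\<delta> t) * ?\<delta>' t) \<le> C * D"
        by eventually_elim (auto simp: norm_mult intro!: mult_mono order.trans[OF norm_ge_zero])
      then show ?thesis ..
    qed
    with app(1) show ?thesis by (simp add: Cusp)
  next
    case Cusp_Infinity
    then obtain \<alpha> where a: "a = Cusp \<alpha>" using ba by (cases a) auto
    have d: "?\<delta> t = Complex (of_rat \<alpha>) ((1 - t) / t)" for t by (simp add: Cusp_Infinity a)
    have "filterlim (\<lambda>t :: real. (1 - t) / t) at_top (at_right 0)" by real_asymp
    then have lim: "filterlim (\<lambda>t. Im (?\<delta> t)) at_top (at_right 0)" by (simp add: d)
    have K: "\<forall>\<^sub>F t in at_right 0. \<bar>Re (?\<delta> t)\<bar> \<le> \<bar>of_rat \<alpha>\<bar>" by (simp add: d)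
    note app = approach_infinity[OF K lim]
    have "\<exists>C. \<forall>\<^sub>F t in at_right 0. cmod (F (?\<delta> t) * ?\<delta>' t) \<le> C" if dec: "cusp_decay F"
    proof -
      obtain C where "\<forall>\<^sub>F t in at_right 0. cmod (F (?\<delta> t)) \<le> C / (Im (?\<delta> t))\<^sup>2" using app(2)[OF dec] by blast
      with at_right_0_unit have "\<forall>\<^sub>F t in at_right 0. cmod (F (?\<delta> t) * ?\<delta>' t) \<le> \<bar>C\<bar> * 4"
      proof eventually_elim
        case (elim t)
        have n: "cmod (?\<delta>' t) = 1 / t\<^sup>2" using elim by (simp add: Cusp_Infinity a cmod_def)
        have "cmod (F (?\<delta> t) * ?\<delta>' t) \<le> C / ((1 - t) / t)\<^sup>2 * (1 / t\<^sup>2)"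
          unfolding norm_mult n using elim by (intro mult_right_mono) (auto simp: d)
        also have "\<dots> = C * (1 / (1 - t)\<^sup>2)" using elim by (simp add: power_divide)
        also have "\<dots> \<le> \<bar>C\<bar> * (1 / (1/2)\<^sup>2)"
          using elim by (intro mult_mono divide_left_mono power_mono mult_pos_pos) auto
        finally show ?case by (simp add: power2_eq_square)
      qed
      then show ?thesis ..
    qed
    with app(1) show ?thesis by (simp add: Cusp_Infinity)
  qed
  then show "filterlim ?\<delta> (cusp_nhds b) (at_right 0)"
    and "cusp_decay F \<Longrightarrow> \<exists>C. \<forall>\<^sub>F t in at_right 0. cmod (F (?\<delta> t) * ?\<delta>' t) \<le> C" by blast+
qed

lemma geodesic_end:
  assumes ba: "b \<noteq> a"
  shows "filterlim (geodesic b a) (cusp_nhds a) (at_left 1)"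
    and "cusp_decay F \<Longrightarrow> \<exists>C. \<forall>\<^sub>F t in at_left 1. cmod (F (geodesic b a t) * geodesic_deriv b a t) \<le> C"
proof -
  have flip: "at_left (1 :: real) = filtermap (\<lambda>t. 1 - t) (at_right 0)"
    using at_left_minus[of "1 :: real"] filtermap_at_right_shift[of 1 "0 :: real", symmetric]
    by (simp add: filtermap_filtermap)
  note ab = geodesic_start[OF ba[symmetric]]
  show "filterlim (geodesic b a) (cusp_nhds a) (at_left 1)"
    unfolding flip filterlim_filtermap geodesic_reverse[OF ba] using ab(1) by simp
  show "\<exists>C. \<forall>\<^sub>F t in at_left 1. cmod (F (geodesic b a t) * geodesic_deriv b a t) \<le> C" if "cusp_decay F"
    unfolding flip eventually_filtermap geodesic_reverse[OF ba] using ab(2)[OF that] by simp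
qed

section \<open>Iterated integrals along geodesics as limits of iterated primitives\<close>

context
  fixes V :: "'v set" and \<omega> :: "'v \<Rightarrow> complex \<Rightarrow> complex" and b a :: cusp
  assumes decay: "\<And>v. v \<in> V \<Longrightarrow> cusp_decay (\<omega> v)" and ba: "b \<noteq> a"
begin

lemma geodesic_continuous: "continuous_on {0<..<1} (geodesic b a)"
  by (intro continuous_at_imp_continuous_on ballI
      has_vector_derivative_continuous[OF geodesic_has_deriv[OF ba]]) auto

lemma holomorphic_geodesic_continuous:
  assumes "F holomorphic_on uhp"
  shows "continuous_on {0<..<1} (\<lambda>t. F (geodesic b a t))"
  by (rule continuous_on_compose2[OF holomorphic_on_imp_continuous_on[OF assms] geodesic_continuous])
     (auto intro: geodesic_uhp[OF ba])

lemma form_geodesic: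
  assumes "v \<in> V"
  shows "continuous_on {0<..<1} (\<lambda>t. \<omega> v (geodesic b a t) * geodesic_deriv b a t)"
    and "\<exists>C. \<forall>t\<in>{0<..<1}. cmod (\<omega> v (geodesic b a t) * geodesic_deriv b a t) \<le> C"
proof -
  show cont: "continuous_on {0<..<1} (\<lambda>t. \<omega> v (geodesic b a t) * geodesic_deriv b a t)"
    using decay[OF assms]
    by (intro continuous_on_mult holomorphic_geodesic_continuous continuous_geodesic_deriv[OF ba])
       (auto simp: cusp_decay_def)
  obtain C1 where "\<forall>\<^sub>F t in at_right 0. cmod (\<omega> v (geodesic b a t) * geodesic_deriv b a t) \<le> C1"
    using geodesic_start(2)[OF ba decay[OF assms]] by blast
  moreover obtain C2 where "\<forall>\<^sub>F t in at_left 1. cmod (\<omega> v (geodesic b a t) * geodesic_deriv b a t) \<le> C2"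
    using geodesic_end(2)[OF ba decay[OF assms]] by blast
  ultimately show "\<exists>C. \<forall>t\<in>{0<..<1}. cmod (\<omega> v (geodesic b a t) * geodesic_deriv b a t) \<le> C"
    by (rule bounded_Ioo[OF cont])
qed

lemma iter_prim_geodesic:
  assumes w: "w \<in> lists V"
  shows "((\<lambda>t. iter_prim \<omega> b w (geodesic b a t)) \<longlongrightarrow> nc_one w) (at_right 0)"
    and "((\<lambda>t. iter_prim \<omega> b w (geodesic b a t)) \<longlongrightarrow> iter_lim V \<omega> b a w) (at_left 1)"
    and "continuous_on {0<..<1} (\<lambda>t. iter_prim \<omega> b w (geodesic b a t))"
    and "\<exists>C. \<forall>t\<in>{0<..<1}. cmod (iter_prim \<omega> b w (geodesic b a t)) \<le> C"
proof -
  show start: "((\<lambda>t. iter_prim \<omega> b w (geodesic b a t)) \<longlongrightarrow> nc_one w) (at_right 0)"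
    by (rule filterlim_compose[OF iter_prim_start[OF decay w] geodesic_start(1)[OF ba]])
  show fin: "((\<lambda>t. iter_prim \<omega> b w (geodesic b a t)) \<longlongrightarrow> iter_lim V \<omega> b a w) (at_left 1)"
    by (rule filterlim_compose[OF iter_prim_lim[OF decay w] geodesic_end(1)[OF ba]])
  have "iter_prim \<omega> b w holomorphic_on uhp"
    using iter_prim_aux[of V \<omega>, OF decay w] by blast
  then show cont: "continuous_on {0<..<1} (\<lambda>t. iter_prim \<omega> b w (geodesic b a t))"
    by (rule holomorphic_geodesic_continuous)
  have bnd: "\<forall>\<^sub>F t in F. cmod (f t) \<le> cmod l + 1" if "(f \<longlongrightarrow> l) F" for f :: "real \<Rightarrow> complex" and l F
    using order_tendstoD(2)[OF tendsto_norm[OF that], of "cmod l + 1"]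
    by (auto elim!: eventually_mono)
  show "\<exists>C. \<forall>t\<in>{0<..<1}. cmod (iter_prim \<omega> b w (geodesic b a t)) \<le> C"
    by (rule bounded_Ioo[OF cont bnd[OF start] bnd[OF fin]])
qed

text \<open>The inner integrals are \<open>iter_prim\<close> along the geodesic, by the fundamental theorem of calculus
  on \<open>(0, x)\<close>; the boundary term at \<open>0\<close> vanishes by the normalization at \<open>b\<close>, and at \<open>x = 1\<close> the
  geodesic has left the upper half plane, so that the limit at \<open>a\<close> takes over.\<close>

lemma iterated_integral_partial:
  assumes w: "w \<in> lists V" and x: "0 < x" "x \<le> 1"
  shows "foldr (\<lambda>\<phi> h x. LINT y:{0<..<x}|lborel. \<phi> y * h y)
      (map (\<lambda>v t. indicator {0<..<1} t *\<^sub>R (\<omega> v (geodesic b a t) * geodesic_deriv b a t)) w) (\<lambda>_. 1) x =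
    (if x < 1 then iter_prim \<omega> b w (geodesic b a x) else iter_lim V \<omega> b a w)"
  using w x
proof (induction w arbitrary: x rule: list.induct)
  case Nil
  show ?case by (simp add: iter_lim_Nil)
next
  case (Cons v w)
  have vw: "v \<in> V" "w \<in> lists V" "v # w \<in> lists V" using Cons.prems by auto
  let ?fold = "\<lambda>w. foldr (\<lambda>\<phi> h x. LINT y:{0<..<x}|lborel. \<phi> y * h y)
      (map (\<lambda>v t. indicator {0<..<1} t *\<^sub>R (\<omega> v (geodesic b a t) * geodesic_deriv b a t)) w) (\<lambda>_. 1)"
  define h where "h t = \<omega> v (geodesic b a t) * geodesic_deriv b a t * iter_prim \<omega> b w (geodesic b a t)" for t
  define G where "G t = iter_prim \<omega> b (v # w) (geodesic b a t)" for t
  have h_cont: "continuous_on {0<..<1} h"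
    unfolding h_def by (intro continuous_on_mult form_geodesic iter_prim_geodesic vw)
  obtain C1 where C1: "\<And>t. t \<in> {0<..<1} \<Longrightarrow> cmod (\<omega> v (geodesic b a t) * geodesic_deriv b a t) \<le> C1"
    using form_geodesic(2)[OF vw(1)] by blast
  obtain C2 where C2: "\<And>t. t \<in> {0<..<1} \<Longrightarrow> cmod (iter_prim \<omega> b w (geodesic b a t)) \<le> C2"
    using iter_prim_geodesic(4)[OF vw(2)] by blast
  have h_bound: "cmod (h t) \<le> C1 * C2" if "t \<in> {0<..<1}" for t
    unfolding h_def norm_mult[of "_ * _"] using C1[OF that] C2[OF that]
    by (intro mult_mono order.trans[OF norm_ge_zero C1[OF that]]) auto
  have G_deriv: "(G has_vector_derivative h t) (at t)" if "0 < t" "t < 1" for t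
    using field_vector_diff_chain_at[OF geodesic_has_deriv[OF ba that]
        iter_prim_deriv[OF decay vw(3) geodesic_uhp[OF ba that]]]
    by (simp add: G_def[abs_def] h_def o_def mult_ac del: iter_prim.simps)
  have "?fold (v # w) x = (LINT y:{0<..<x}|lborel. h y)"
    using Cons.prems Cons.IH[OF vw(2)] 
    by (simp add: h_def) (intro set_lebesgue_integral_cong, auto)
  also have "\<dots> = (if x < 1 then G x else iter_lim V \<omega> b a (v # w)) - 0"
  proof (rule integral_Ioo_FTC)
    show "0 < x" by fact
    show "(G has_vector_derivative h t) (at t)" if "0 < t" "t < x" for t
      using that Cons.prems by (intro G_deriv) auto
    show "isCont h t" if "0 < t" "t < x" for t
      using that Cons.prems h_cont by (auto simp: continuous_on_eq_continuous_at)
    show "set_integrable lborel {0<..<x} h"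
      by (rule set_integrable_bounded_Ioo[OF h_cont h_bound]) (use Cons.prems in auto)
    show "(G \<longlongrightarrow> 0) (at_right 0)"
      using iter_prim_geodesic(1)[OF vw(3)] unfolding G_def nc_one_def by simp
    show "(G \<longlongrightarrow> (if x < 1 then G x else iter_lim V \<omega> b a (v # w))) (at_left x)"
    proof (cases "x < 1")
      case True
      then have "isCont G x"
        using has_vector_derivative_continuous[OF G_deriv] Cons.prems by simp
      then show ?thesis using True
        by (simp add: isCont_def filterlim_at_split)
    next
      case False
      then show ?thesis using Cons.prems iter_prim_geodesic(2)[OF vw(3)] unfolding G_def by simp
    qed
  qed
  finally show ?case by (simp add: G_def del: iter_prim.simps)
qed

lemma iterated_integral_eq:
  assumes w: "w \<in> lists V"
  shows "iterated_integral b a (map \<omega> w) = iter_lim V \<omega> b a w"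
proof -
  define \<phi> where "\<phi> v t = indicator {0<..<1} t *\<^sub>R (\<omega> v (geodesic b a t) * geodesic_deriv b a t)" for v t
  have int: "integrable lborel \<psi>" if \<psi>: "\<psi> \<in> set (map \<phi> w)" for \<psi>
  proof -
    obtain v where v: "v \<in> V" "\<psi> = \<phi> v" using \<psi> w by auto
    obtain C where "\<And>t. t \<in> {0<..<1} \<Longrightarrow> cmod (\<omega> v (geodesic b a t) * geodesic_deriv b a t) \<le> C"
      using form_geodesic(2)[OF v(1)] by blast
    from set_integrable_bounded_Ioo[OF form_geodesic(1)[OF v(1)] this, of 1]
    show ?thesis by (simp add: set_integrable_def v(2) \<phi>_def[abs_def])
  qed
  have "iterated_integral b a (map \<omega> w) =
      (\<integral>t. indicator (open_simplex (length (map \<phi> w))) t *\<^sub>R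
        ((\<Prod>i<length (map \<phi> w). (map \<phi> w ! i) (t i)) * 1) \<partial>PiM {..<length (map \<phi> w)} (\<lambda>_. lborel))"
    unfolding iterated_integral_def set_lebesgue_integral_def length_map
  proof (rule Bochner_Integration.integral_cong[OF refl])
    fix t
    have "(\<Prod>i<length w. (map \<omega> w ! i) (geodesic b a (t i)) * vector_derivative (geodesic b a) (at (t i))) =
        (\<Prod>i<length w. (map \<phi> w ! i) (t i))" if "t \<in> open_simplex (length w)"
    proof (rule prod.cong[OF refl])
      fix i assume "i \<in> {..<length w}"
      moreover from this have "0 < t i" "t i < 1" using that by (auto simp: open_simplex_def)
      ultimately show "(map \<omega> w ! i) (geodesic b a (t i)) * vector_derivative (geodesic b a) (at (t i)) =
          (map \<phi> w ! i) (t i)"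
        using vector_derivative_at[OF geodesic_has_deriv[OF ba, of "t i"]] by (simp add: \<phi>_def)
    qed
    then show "indicator (open_simplex (length w)) t *\<^sub>R
        (\<Prod>i<length w. (map \<omega> w ! i) (geodesic b a (t i)) * vector_derivative (geodesic b a) (at (t i))) =
      indicator (open_simplex (length w)) t *\<^sub>R ((\<Prod>i<length w. (map \<phi> w ! i) (t i)) * 1)"
      by (cases "t \<in> open_simplex (length w)") auto
  qed
  also have "\<dots> = foldr (\<lambda>\<phi> h x. LINT y:{0<..<x}|lborel. \<phi> y * h y) (map \<phi> w) (\<lambda>_. 1) 1"
    by (rule simplex_integral_foldr[where g = "\<lambda>_. 1" and B = 1]) (use int in auto)
  also have "\<dots> = iter_lim V \<omega> b a w"
    using iterated_integral_partial[OF w, of 1] unfolding \<phi>_def[abs_def] by simp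
  finally show ?thesis .
qed

end

lemma nc_J_eq_iter_lim:
  assumes decay: "\<And>v. v \<in> V \<Longrightarrow> cusp_decay (\<omega> v)"
  shows "nc_J V \<omega> b a = iter_lim V \<omega> b a"
proof (cases "b = a")
  case True
  then show ?thesis using iter_lim_same[OF decay, of V] by (simp add: nc_J_def nc_ring_simps)
next
  case False
  have "iter_lim V \<omega> b a [] = 1" by (rule iter_lim_Nil)
  moreover have "iter_lim V \<omega> b a w = 0" if "w \<notin> lists V" for w using that by (simp add: iter_lim_def)
  ultimately show ?thesis
    using False iterated_integral_eq[of V \<omega>, OF decay False] by (auto simp: nc_J_def fun_eq_iff)
qed

section \<open>The automorphisms induced by pull-back\<close>

context
  fixes V :: "'v set" and \<omega> :: "'v \<Rightarrow> complex \<Rightarrow> complex" and \<Gamma> :: "(int^2^2) set"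
  assumes fin: "finite V" and indep: "lin_indep_forms V \<omega>" and \<Gamma>: "subgroup \<Gamma> SL2Z"
    and stable: "\<And>\<gamma> F. \<gamma> \<in> \<Gamma> \<Longrightarrow> F \<in> span_forms V \<omega> \<Longrightarrow> pullback_form (frac_lin \<gamma>) F \<in> span_forms V \<omega>"
begin

lemma pullback_matrix:
  assumes "\<gamma> \<in> \<Gamma>" "v \<in> V" "z \<in> uhp"
  shows "pullback_form (frac_lin \<gamma>) (\<omega> v) z = (\<Sum>u\<in>V. pullback_matrix V \<omega> \<gamma> v u * \<omega> u z)"
proof -
  have "\<exists>c. \<forall>z\<in>uhp. pullback_form (frac_lin \<gamma>) (\<omega> v) z = (\<Sum>u\<in>V. c u * \<omega> u z)" if "v \<in> V" for v
  proof -
    have "\<omega> v \<in> span_forms V \<omega>"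
      unfolding span_forms_def using that fin
      by (intro CollectI exI[of _ "\<lambda>u. if u = v then 1 else 0"]) (simp add: if_distribR if_distrib cong: if_cong)
    from stable[OF assms(1) this] show ?thesis by (simp add: span_forms_def)
  qed
  then have "\<exists>g. \<forall>v\<in>V. \<forall>z\<in>uhp. pullback_form (frac_lin \<gamma>) (\<omega> v) z = (\<Sum>u\<in>V. g v u * \<omega> u z)"
    by (intro bchoice) blast
  from someI_ex[OF this] show ?thesis
    unfolding pullback_matrix_def using assms(2,3) by blast
qed

text \<open>Pulling \<open>\<omega>\<^sub>v\<close> back by \<open>\<gamma>\<close> and then by \<open>\<beta>\<close> gives back \<open>\<omega>\<^sub>v\<close>; linear independence allows the
  coefficients to be compared.\<close>

lemma pullback_matrix_inverse:
  assumes \<gamma>: "\<gamma> \<in> \<Gamma>" "\<beta> \<in> \<Gamma>" "\<gamma> ** \<beta> = mat 1" and vu: "v \<in> V" "u \<in> V"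
  shows "(\<Sum>x\<in>V. pullback_matrix V \<omega> \<gamma> v x * pullback_matrix V \<omega> \<beta> x u) = (if v = u then 1 else 0)"
proof -
  let ?g = "pullback_matrix V \<omega> \<gamma>" and ?h = "pullback_matrix V \<omega> \<beta>"
  have SL: "\<gamma> \<in> carrier SL2Z" "\<beta> \<in> carrier SL2Z" using \<gamma> subgroup.subset[OF \<Gamma>] by auto
  define c where "c u = (\<Sum>x\<in>V. ?g v x * ?h x u) - (if v = u then 1 else 0)" for u
  have "(\<Sum>u\<in>V. c u * \<omega> u z) = 0" if z: "z \<in> uhp" for z
  proof -
    have \<beta>z: "frac_lin \<beta> z \<in> uhp" by (rule frac_lin_uhp[OF SL(2) z])
    have 1: "frac_lin \<gamma> (frac_lin \<beta> z) = z"
      using frac_lin_mult[OF SL z] by (simp add: \<gamma>(3))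
    have 2: "aut_factor \<gamma> (frac_lin \<beta> z) * aut_factor \<beta> z = 1"
      using aut_factor_mult[OF SL(2) z, of \<gamma>] by (simp add: \<gamma>(3) aut_factor_def mat_2)
    have "\<omega> v z = \<omega> v z / (aut_factor \<gamma> (frac_lin \<beta> z) * aut_factor \<beta> z) ^ 2"
      by (simp add: 2)
    also have "\<dots> = pullback_form (frac_lin \<gamma>) (\<omega> v) (frac_lin \<beta> z) * deriv (frac_lin \<beta>) z"
      by (simp add: pullback_form_def deriv_frac_lin SL z \<beta>z 1 power_mult_distrib)
    also have "\<dots> = (\<Sum>x\<in>V. ?g v x * pullback_form (frac_lin \<beta>) (\<omega> x) z)"
      unfolding pullback_matrix[OF \<gamma>(1) vu(1) \<beta>z]
      by (simp add: pullback_form_def[of "frac_lin \<beta>"] sum_distrib_left sum_distrib_right mult_ac)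
    also have "\<dots> = (\<Sum>x\<in>V. \<Sum>u\<in>V. ?g v x * ?h x u * \<omega> u z)"
      by (simp add: pullback_matrix[OF \<gamma>(2) _ z] sum_distrib_left mult_ac)
    also have "\<dots> = (\<Sum>u\<in>V. (\<Sum>x\<in>V. ?g v x * ?h x u) * \<omega> u z)"
      by (subst sum.swap) (simp add: sum_distrib_right)
    finally have "\<omega> v z = (\<Sum>u\<in>V. (\<Sum>x\<in>V. ?g v x * ?h x u) * \<omega> u z)" .
    moreover have "(\<Sum>u\<in>V. (if v = u then 1 else 0) * \<omega> u z) = \<omega> v z"
      using fin vu(1) by (simp add: if_distribR if_distrib cong: if_cong)
    ultimately show ?thesis
      by (simp add: c_def left_diff_distrib sum_subtractf)
  qed
  then have "c u = 0" using indep vu(2) unfolding lin_indep_forms_def by blast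
  then show ?thesis by (simp add: c_def)
qed

lemma lower_star_eq:
  assumes \<gamma>: "\<gamma> \<in> \<Gamma>" and S: "S \<in> carrier (nc_ring V)"
  shows "lower_star V \<omega> \<gamma> S = nc_subst V (pullback_matrix V \<omega> \<gamma>) S"
proof -
  let ?P = "\<lambda>\<phi>. cont_alg_automorphism V \<phi> \<and> (\<forall>u\<in>V. \<phi> (nc_var u) =
      (\<lambda>w. \<Sum>v\<in>V. nc_smult (pullback_matrix V \<omega> \<gamma> v u) (nc_var v) w))"
  have SL: "\<gamma> \<in> carrier SL2Z" using \<gamma> subgroup.subset[OF \<Gamma>] by auto
  have adj: "adj \<gamma> \<in> \<Gamma>" using subgroup.m_inv_closed[OF \<Gamma> \<gamma>] SL2Z_inv[OF SL] by simp
  have "?P (nc_subst V (pullback_matrix V \<omega> \<gamma>))"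
    using cont_alg_automorphism_nc_subst[OF fin pullback_matrix_inverse[OF \<gamma> adj adj_SL2Z(3)[OF SL]]
        pullback_matrix_inverse[OF adj \<gamma> adj_SL2Z(2)[OF SL]]] nc_subst_var[OF fin] by blast
  then have "?P (lower_star V \<omega> \<gamma>)" unfolding lower_star_def by (rule someI[of ?P])
  then show ?thesis
    by (intro cont_alg_automorphism_unique[OF fin _ _ S]) (auto simp: nc_subst_var[OF fin])
qed

end

section \<open>The cocycle\<close>

theorem mainTheorem3:
  fixes V :: "'v set"
    and f \<omega> :: "'v \<Rightarrow> complex \<Rightarrow> complex"
    and r m :: "'v \<Rightarrow> nat"
    and \<Gamma> :: "(int^2^2) set"
  assumes "finite V"
    and "\<And>v. v \<in> V \<Longrightarrow> \<exists>G. congruence_subgroup G \<and> cusp_form G (2 * r v) (f v)"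
    and "\<And>v. v \<in> V \<Longrightarrow> 1 \<le> m v \<and> m v \<le> 2 * r v - 1"
    and "\<And>v z. v \<in> V \<Longrightarrow> z \<in> upper_half_plane \<Longrightarrow> \<omega> v z = f v z * z ^ (m v - 1)"
    and "lin_indep_forms V \<omega>"
    and "subgroup \<Gamma> SL2Z"
    and "\<And>\<gamma> F. \<gamma> \<in> \<Gamma> \<Longrightarrow> F \<in> span_forms V \<omega> \<Longrightarrow>
           pullback_form (frac_lin \<gamma>) F \<in> span_forms V \<omega>"
  shows "(\<forall>a. zeta V \<omega> a \<in> nc_cocycles (SL2Z\<lparr>carrier := \<Gamma>\<rparr>) (nc_Pi V) (lower_star V \<omega>)) \<and>
         (\<forall>a b. (zeta V \<omega> a, zeta V \<omega> b) \<in>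
                  cohomologous (SL2Z\<lparr>carrier := \<Gamma>\<rparr>) (nc_Pi V) (lower_star V \<omega>))"
proof -
  have decay: "cusp_decay (\<omega> v)" if "v \<in> V" for v
    using assms(2)[OF that] assms(3,4) that by (blast intro: cusp_decay_form)
  have SL: "\<gamma> \<in> carrier SL2Z" if "\<gamma> \<in> \<Gamma>" for \<gamma> using that subgroup.subset[OF assms(6)] by auto
  let ?J = "iter_lim V \<omega>"
  have Pi: "?J b a \<in> carrier (nc_Pi V)" for b a by (rule iter_lim_Pi[OF decay])
  have comp: "nc_mult (?J b a) (?J c b) = ?J c a" for a b c
    by (rule iter_lim_compose[OF decay, symmetric])
  have zeta: "zeta V \<omega> a \<gamma> = ?J (cusp_act \<gamma> a) a" for a \<gamma>
    unfolding zeta_def by (rule nc_J_eq_iter_lim[OF decay])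
  have star: "lower_star V \<omega> \<gamma> (?J b a) = ?J (cusp_act \<gamma> b) (cusp_act \<gamma> a)" if "\<gamma> \<in> \<Gamma>" for \<gamma> a b
  proof -
    have "lower_star V \<omega> \<gamma> (?J b a) = nc_subst V (pullback_matrix V \<omega> \<gamma>) (?J b a)"
      using Pi by (intro lower_star_eq[OF assms(1,5,6,7) that]) (auto simp: nc_Pi_simps)
    also have "\<dots> = ?J (cusp_act \<gamma> b) (cusp_act \<gamma> a)"
      by (rule iter_lim_equivariant[OF decay SL[OF that] pullback_matrix[OF assms(1,5,6,7) that], symmetric])
    finally show ?thesis .
  qed
  have cocycle: "zeta V \<omega> a \<in> nc_cocycles (SL2Z\<lparr>carrier := \<Gamma>\<rparr>) (nc_Pi V) (lower_star V \<omega>)" for a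
    by (simp add: nc_cocycles_def zeta Pi star comp nc_Pi_simps(2) cusp_act_mult SL)
  have inv: "inv\<^bsub>nc_Pi V\<^esub> (?J b a) = ?J a b" for a b
    by (rule monoid.inv_char[OF monoid_nc_Pi])
       (simp_all add: Pi nc_Pi_simps(2,3) comp iter_lim_same[OF decay])
  \<comment> \<open>the path from \<open>\<gamma> a\<close> to \<open>\<gamma> b\<close> to \<open>b\<close> to \<open>a\<close>, read from right to left\<close>
  have coh: "zeta V \<omega> a \<gamma> = ?J b a \<otimes>\<^bsub>nc_Pi V\<^esub> zeta V \<omega> b \<gamma> \<otimes>\<^bsub>nc_Pi V\<^esub>
      inv\<^bsub>nc_Pi V\<^esub> (lower_star V \<omega> \<gamma> (?J b a))" if "\<gamma> \<in> \<Gamma>" for a b \<gamma>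
    by (simp add: zeta star[OF that] inv comp nc_Pi_simps(2))
  have "(zeta V \<omega> a, zeta V \<omega> b) \<in> cohomologous (SL2Z\<lparr>carrier := \<Gamma>\<rparr>) (nc_Pi V) (lower_star V \<omega>)" for a b
    unfolding cohomologous_def using cocycle coh Pi[of b a]
    by (auto intro!: bexI[of _ "?J b a"])
  with cocycle show ?thesis by blast
qed

end
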